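(* Let $d\ge 3$, let $T$ be a $d$-regular metric tree, let $B\subset T$ be a ball of radius $R$ with center $O$, and let $f:B\to B$ be a $(\lambda,c)$-self-quasi-isometry of this ball. Then $$d(f(O),O)\le\min\{R,\;H+c+\lambda(c+1)\},$$ where $H=A_1\lambda^2c$ with $A_1=312$.
   Context: A $d$-regular metric tree is the geodesic metric space obtained from the tree all of whose vertices have degree $d$ by giving each edge length $1$; $d(\cdot,\cdot)$ also denotes its distance. For $\lambda\ge 1$, $c\ge 0$, a map $f:E\to F$ between metric spaces is a $(\lambda,c)$-quasi-isometry if $\frac1\lambda|x-y|_E-c\le |f(x)-f(y)|_F\le \lambda|x-y|_E+c$ for all $x,y\in E$; it is a self-quasi-isometry if $E=F$. The quantity $H$ is the constant of the quantitative Morse lemma in a tree ($0$-hyperbolic space): every $(\lambda,c)$-quasi-geodesic (a $(\lambda,c)$-quasi-isometry from a real interval) lies in the $H$-neighborhood of any geodesic segment connecting its endpoints, where $H=\lambda^2(A_1c+A_2\delta)$ in a $\delta$-hyperbolic space with universal constants $A_1,A_2$. *)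

theory Defs
  imports "HOL-Analysis.Analysis"
begin

section \<open>Regular trees\<close>

text \<open>
  Simple graphs are given by a vertex set and a set of two-element edges. The predicate
  \<open>tree\<close> of the entry Graph-Theory is not used: it forbids directed cycles only, and counts
  \<open>a, b, a\<close> as a cycle in a symmetric digraph.
\<close>

definition simple_graph :: "'v set \<Rightarrow> 'v set set \<Rightarrow> bool" where
  "simple_graph V E \<longleftrightarrow> (\<forall>e\<in>E. e \<subseteq> V \<and> card e = 2)"

definition walk :: "'v set set \<Rightarrow> 'v list \<Rightarrow> bool" where
  "walk E p \<longleftrightarrow> p \<noteq> [] \<and> successively (\<lambda>u v. {u, v} \<in> E) p"

definition connected_graph :: "'v set \<Rightarrow> 'v set set \<Rightarrow> bool" where
  "connected_graph V E \<longleftrightarrow> V \<noteq> {} \<and> (\<forall>u\<in>V. \<forall>v\<in>V. \<exists>p. walk E p \<and> hd p = u \<and> last p = v)"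

definition cycle :: "'v set set \<Rightarrow> 'v list \<Rightarrow> bool" where
  "cycle E p \<longleftrightarrow> walk E p \<and> distinct p \<and> 3 \<le> length p \<and> {last p, hd p} \<in> E"

definition tree :: "'v set \<Rightarrow> 'v set set \<Rightarrow> bool" where
  "tree V E \<longleftrightarrow> simple_graph V E \<and> connected_graph V E \<and> (\<nexists>p. cycle E p)"

definition degree :: "'v set set \<Rightarrow> 'v \<Rightarrow> nat" where
  "degree E v = card {e \<in> E. v \<in> e}"

text \<open>
  Since \<open>card\<close> of an infinite set is \<open>0\<close>, regularity of degree \<open>d > 0\<close> includes local finiteness.
\<close>

definition regular_tree :: "nat \<Rightarrow> 'v set \<Rightarrow> 'v set set \<Rightarrow> bool" where
  "regular_tree d V E \<longleftrightarrow> tree V E \<and> (\<forall>v\<in>V. degree E v = d)"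


section \<open>The metric tree\<close>

text \<open>
  Points of the geometric realization are written in barycentric coordinates:
  \<open>edge_point u v s\<close> is the point at distance \<open>s\<close> from \<open>u\<close> on the unit edge \<open>{u, v}\<close>, so that
  \<open>edge_point u v s = edge_point v u (1 - s)\<close>, and the endpoints of different edges are
  identified as they should be. If every vertex has positive degree, \<open>metric_tree E\<close> contains
  all vertices.
\<close>

definition edge_point :: "'v \<Rightarrow> 'v \<Rightarrow> real \<Rightarrow> 'v \<Rightarrow> real" where
  "edge_point u v s = (\<lambda>w. if w = u then 1 - s else if w = v then s else 0)"

definition metric_tree :: "'v set set \<Rightarrow> ('v \<Rightarrow> real) set" where
  "metric_tree E = {edge_point u v s |u v s. {u, v} \<in> E \<and> s \<in> {0..1}}"

text \<open>
  \<open>chain E x y l\<close> means that the points \<open>x\<close> and \<open>y\<close> are joined by a path of length \<open>l\<close> that consists of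
  finitely many segments, each contained in one edge. The distance is the associated length metric,
  extended by \<open>0\<close> outside the realization because the library's metric spaces ask for a
  nonnegative distance on the whole type.
\<close>

inductive chain :: "'v set set \<Rightarrow> ('v \<Rightarrow> real) \<Rightarrow> ('v \<Rightarrow> real) \<Rightarrow> real \<Rightarrow> bool" for E x where
  refl: "x \<in> metric_tree E \<Longrightarrow> chain E x x 0"
| step: "chain E x (edge_point u v s) l \<Longrightarrow> {u, v} \<in> E \<Longrightarrow> s \<in> {0..1} \<Longrightarrow> t \<in> {0..1}
    \<Longrightarrow> chain E x (edge_point u v t) (l + \<bar>s - t\<bar>)"

definition tree_dist :: "'v set set \<Rightarrow> ('v \<Rightarrow> real) \<Rightarrow> ('v \<Rightarrow> real) \<Rightarrow> real" where
  "tree_dist E x y =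
    (if x \<in> metric_tree E \<and> y \<in> metric_tree E then Inf {l. chain E x y l} else 0)"

lemma edge_point_swap: "u \<noteq> v \<Longrightarrow> edge_point u v s = edge_point v u (1 - s)"
  by (auto simp: edge_point_def fun_eq_iff)

lemma simple_graph_edge_neq: "simple_graph V E \<Longrightarrow> {u, v} \<in> E \<Longrightarrow> u \<noteq> v"
  by (auto simp: simple_graph_def)

lemma edge_point_in_metric_tree [intro]:
  "{u, v} \<in> E \<Longrightarrow> 0 \<le> s \<Longrightarrow> s \<le> 1 \<Longrightarrow> edge_point u v s \<in> metric_tree E"
  by (auto simp: metric_tree_def)

lemma chain_in_metric_tree: "chain E x y l \<Longrightarrow> x \<in> metric_tree E \<and> y \<in> metric_tree E"
  by (induction rule: chain.induct) auto

lemma chain_coord_le: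
  assumes "simple_graph V E" "chain E x y l"
  shows "\<bar>x w - y w\<bar> \<le> l"
  using assms(2)
proof (induction rule: chain.induct)
  case (step u v s l t)
  have "\<bar>edge_point u v s w - edge_point u v t w\<bar> \<le> \<bar>s - t\<bar>"
    by (auto simp: edge_point_def)
  with step.IH show ?case by linarith
qed simp

lemma chain_trans:
  assumes "chain E x y l" "chain E y z l'"
  shows "chain E x z (l + l')"
  using assms(2)
proof (induction rule: chain.induct)
  case refl
  then show ?case using assms(1) by simp
next
  case (step u v s l'' t)
  then show ?case using chain.step[of E x u v s "l + l''" t] by (simp add: add.assoc)
qed

lemma chain_segment:
  "{u, v} \<in> E \<Longrightarrow> s \<in> {0..1} \<Longrightarrow> t \<in> {0..1} \<Longrightarrow> chain E (edge_point u v s) (edge_point u v t) \<bar>s - t\<bar>"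
  using chain.step[OF chain.refl, of u v s E t] by (auto simp: metric_tree_def)

lemma chain_sym: "chain E x y l \<Longrightarrow> chain E y x l"
proof (induction rule: chain.induct)
  case (step u v s l t)
  have "chain E (edge_point u v t) (edge_point u v s) \<bar>t - s\<bar>"
    by (intro chain_segment step.hyps)
  from chain_trans[OF this step.IH] show ?case by (simp add: add.commute abs_minus_commute)
qed (rule chain.refl)

text \<open>The vertex \<open>u\<close> as a point of the realization is \<open>edge_point u v 0\<close>, for any \<open>v\<close>.\<close>

lemma edge_point_vertex: "edge_point u v 0 = edge_point u v' 0"
  by (auto simp: edge_point_def)

lemma chain_walk:
  assumes "simple_graph V E" "walk E p" "2 \<le> length p"
  shows "\<exists>l. chain E (edge_point (hd p) a 0) (edge_point (last p) b 0) l"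
  using assms(2,3)
proof (induction p arbitrary: a)
  case (Cons u p)
  then obtain v q where p: "p = v # q" by (cases p) auto
  have e: "{u, v} \<in> E" and w: "walk E p"
    using Cons.prems p by (auto simp: walk_def)
  have "u \<noteq> v" using simple_graph_edge_neq[OF assms(1) e] .
  then have "chain E (edge_point u a 0) (edge_point v b' 0) 1" for b'
    using chain_segment[OF e, of 0 1] edge_point_swap[of u v 1]
      edge_point_vertex[of u a v] edge_point_vertex[of v b' u] by simp
  note c = this
  show ?case
  proof (cases q)
    case Nil
    then show ?thesis using c[of b] p by auto
  next
    case (Cons v' q')
    then have "\<exists>l. chain E (edge_point (hd p) a 0) (edge_point (last p) b 0) l"
      using Cons.IH w p by simp
    then show ?thesis using chain_trans[OF c[of a]] p by fastforce
  qed
qed simp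

lemma chain_exists:
  assumes "simple_graph V E" "connected_graph V E" "x \<in> metric_tree E" "y \<in> metric_tree E"
  shows "\<exists>l. chain E x y l"
proof -
  obtain u u' s where x: "x = edge_point u u' s" "{u, u'} \<in> E" "s \<in> {0..1}"
    using assms(3) by (auto simp: metric_tree_def)
  obtain v v' t where y: "y = edge_point v v' t" "{v, v'} \<in> E" "t \<in> {0..1}"
    using assms(4) by (auto simp: metric_tree_def)
  have "u \<in> V" "v \<in> V" using assms(1) x(2) y(2) by (auto simp: simple_graph_def)
  then obtain p where p: "walk E p" "hd p = u" "last p = v"
    using assms(2) by (auto simp: connected_graph_def)
  have xu: "chain E x (edge_point u u' 0) \<bar>s - 0\<bar>" and vy: "chain E (edge_point v v' 0) y \<bar>0 - t\<bar>"
    unfolding x(1) y(1) by (intro chain_segment x y; simp)+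
  have "\<exists>l. chain E (edge_point u u' 0) (edge_point v v' 0) l"
  proof (cases "2 \<le> length p")
    case True
    then show ?thesis using chain_walk[OF assms(1) p(1) True] p by auto
  next
    case False
    then have "u = v" using p by (cases p; cases "tl p") (auto simp: walk_def)
    moreover have "edge_point v v' 0 \<in> metric_tree E" using y(2) by auto
    ultimately show ?thesis using chain.refl edge_point_vertex[of u u' v'] by metis
  qed
  then show ?thesis using chain_trans xu vy by meson
qed

lemma tree_dist_le:
  assumes "simple_graph V E" "chain E x y l"
  shows "tree_dist E x y \<le> l"
proof -
  have "bdd_below {l. chain E x y l}"
    using chain_coord_le[OF assms(1), of x y _ undefined] by (intro bdd_belowI[of _ 0]) fastforce
  then show ?thesis
    using chain_in_metric_tree[OF assms(2)] assms(2) by (simp add: tree_dist_def cInf_lower)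
qed

lemma tree_dist_greatest:
  assumes "tree V E" "x \<in> metric_tree E" "y \<in> metric_tree E" "\<And>l. chain E x y l \<Longrightarrow> a \<le> l"
  shows "a \<le> tree_dist E x y"
  using chain_exists[of V E x y] assms
  by (auto simp: tree_dist_def tree_def intro!: cInf_greatest)

lemma tree_dist_segment:
  assumes "tree V E" "{u, v} \<in> E" "s \<in> {0..1}" "t \<in> {0..1}"
  shows "tree_dist E (edge_point u v s) (edge_point u v t) = \<bar>s - t\<bar>"
proof (rule antisym)
  have sg: "simple_graph V E" using assms(1) by (simp add: tree_def)
  show "tree_dist E (edge_point u v s) (edge_point u v t) \<le> \<bar>s - t\<bar>"
    by (rule tree_dist_le[OF sg chain_segment[OF assms(2-4)]])
  show "\<bar>s - t\<bar> \<le> tree_dist E (edge_point u v s) (edge_point u v t)"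
  proof (rule tree_dist_greatest[OF assms(1)])
    fix l assume "chain E (edge_point u v s) (edge_point u v t) l"
    from chain_coord_le[OF sg this, of u] show "\<bar>s - t\<bar> \<le> l"
      by (simp add: edge_point_def)
  qed (use assms in auto)
qed

theorem Metric_space_metric_tree:
  assumes "tree V E"
  shows "Metric_space (metric_tree E) (tree_dist E)"
proof
  have sg: "simple_graph V E" and con: "connected_graph V E"
    using assms by (auto simp: tree_def)
  have coord_le: "\<bar>x w - y w\<bar> \<le> tree_dist E x y"
    if "x \<in> metric_tree E" "y \<in> metric_tree E" for x y w
    using that chain_coord_le[OF sg] by (intro tree_dist_greatest[OF assms])
  show "0 \<le> tree_dist E x y" for x y
  proof (cases "x \<in> metric_tree E \<and> y \<in> metric_tree E")
    case True
    then show ?thesis using coord_le[of x y undefined] by linarith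
  qed (auto simp: tree_dist_def)
  have "chain E x y = chain E y x" for x y
    using chain_sym by blast
  then show "tree_dist E x y = tree_dist E y x" for x y
    by (simp add: tree_dist_def conj_commute)
  fix x y z assume x: "x \<in> metric_tree E" and y: "y \<in> metric_tree E"
  show "tree_dist E x y = 0 \<longleftrightarrow> x = y"
  proof
    assume "tree_dist E x y = 0"
    then have "x w = y w" for w using coord_le[OF x y, of w] by simp
    then show "x = y" by auto
  next
    assume "x = y"
    then show "tree_dist E x y = 0"
      using tree_dist_le[OF sg chain.refl[OF x]] coord_le[OF x y, of undefined] by simp
  qed
  assume z: "z \<in> metric_tree E"
  have "tree_dist E x z - l \<le> tree_dist E y z" if "chain E x y l" for l
    using tree_dist_le[OF sg chain_trans[OF that]]
    by (intro tree_dist_greatest[OF assms y z]) (simp add: algebra_simps)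
  then have "tree_dist E x z - tree_dist E y z \<le> tree_dist E x y"
    by (intro tree_dist_greatest[OF assms x y]) (simp add: algebra_simps)
  then show "tree_dist E x z \<le> tree_dist E x y + tree_dist E y z" by simp
qed


section \<open>Quasi-isometries\<close>

text \<open>Coarse surjectivity is not part of the notion of quasi-isometry.\<close>

definition quasi_isometry ::
  "real \<Rightarrow> real \<Rightarrow> 'a set \<Rightarrow> ('a \<Rightarrow> 'a \<Rightarrow> real) \<Rightarrow> 'b set \<Rightarrow> ('b \<Rightarrow> 'b \<Rightarrow> real) \<Rightarrow> ('a \<Rightarrow> 'b) \<Rightarrow> bool" where
  "quasi_isometry lam c E dE F dF f \<longleftrightarrow> f \<in> E \<rightarrow> F \<and>
    (\<forall>x\<in>E. \<forall>y\<in>E. 1 / lam * dE x y - c \<le> dF (f x) (f y) \<and> dF (f x) (f y) \<le> lam * dE x y + c)"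

definition self_quasi_isometry ::
  "real \<Rightarrow> real \<Rightarrow> 'a set \<Rightarrow> ('a \<Rightarrow> 'a \<Rightarrow> real) \<Rightarrow> ('a \<Rightarrow> 'a) \<Rightarrow> bool" where
  "self_quasi_isometry lam c E dE f \<longleftrightarrow> quasi_isometry lam c E dE E dE f"

text \<open>
  The constant of the Morse lemma in a \<open>\<delta>\<close>-hyperbolic space is \<open>\<lambda>\<^sup>2 (A\<^sub>1 c + A\<^sub>2 \<delta>)\<close>. A tree has
  \<open>\<delta> = 0\<close>, so only \<open>A\<^sub>1 = 312\<close> matters;
  \<open>\<lambda>\<close> is written \<open>lam\<close>.
\<close>

definition morse_A1 :: real where
  "morse_A1 = 312"

definition morse_const_tree :: "real \<Rightarrow> real \<Rightarrow> real" where
  "morse_const_tree lam c = morse_A1 * lam\<^sup>2 * c"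

end

theory Submission
  imports Defs "HOL-Library.Transitive_Closure_Table"
begin

text \<open>
  Let \<open>p\<^sub>0\<close> be the centre and \<open>y = f p\<^sub>0\<close>, and call the set of points whose geodesic from \<open>p\<^sub>0\<close> runs
  through \<open>z\<close> the shadow of \<open>z\<close>. Suppose that \<open>y\<close> is further from \<open>p\<^sub>0\<close> than claimed, and choose \<open>z\<close> on the
  geodesic from \<open>p\<^sub>0\<close> to \<open>y\<close>, both deep (more than \<open>lam + 3/2 lam c\<close> away from \<open>p\<^sub>0\<close>) and more than
  \<open>lam\<^sup>2 c + 3/2 c\<close> away from \<open>y\<close>. The contradiction is that \<open>f\<close> squeezes a whole branch of the ball
  into the shadow of \<open>z\<close>, which has too few ends to receive it.

  A whole branch enters the shadow. Let \<open>u\<close> and \<open>v\<close> lie in different branches at \<open>p\<^sub>0\<close>. If neither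
  \<open>f u\<close> nor \<open>f v\<close> were in the shadow of \<open>z\<close>, the images of the geodesics from \<open>u\<close> to \<open>p\<^sub>0\<close> and from \<open>p\<^sub>0\<close> to
  \<open>v\<close> would both pass near \<open>z\<close>, at two points that are close to each other. Their preimages lie on
  different sides of \<open>p\<^sub>0\<close>, so both are close to \<open>p\<^sub>0\<close>, and \<open>y\<close> would be close to \<open>z\<close>. This is the only
  case of the Morse lemma that is involved, and it is \<open>bounded_backtracking\<close>.

  The branch has many independent ends. Let \<open>d\<close> be the degree. On the sphere of radius \<open>R\<close> the branch
  carries \<open>(d - 1)\<^sup>n\<close> points, each at distance at least \<open>K = R - n\<close> from the geodesics between the others
  (\<open>opposite_branches\<close>). In a tree, a geodesic between two image points stays close to the image of the
  geodesic between their preimages, even though \<open>f\<close> need not be continuous; so each image point is at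
  distance at least \<open>K / lam - 3/2 c\<close> from the geodesics between the others
  (\<open>gromov_product_quasi_isometry\<close>).

  The shadow has few ends. Points of the ball that are independent in this sense, with a bound larger
  than \<open>\<kappa>\<close>, have already separated at distance \<open>R - \<kappa>\<close> from \<open>p\<^sub>0\<close>, so there are essentially no more of
  them than points of the shadow on the sphere of radius \<open>R - \<kappa>\<close> (\<open>independent_card_le_sphere\<close>), and
  these are at most \<open>(d - 1)\<^bsup>n - 1\<^esup>\<close> as soon as \<open>z\<close> is deep enough (\<open>card_shadow_sphere_le\<close>). With \<open>n\<close> the
  largest integer for which \<open>K / lam - 3/2 c\<close> is positive, the inequality \<open>2 - 1/lam \<le> lam\<close> shows that
  depth \<open>lam + 3/2 lam c\<close> suffices. This is where the term \<open>lam\<close> of the bound comes from.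

  The argument only sees the metric tree as a geodesic space with the four-point condition in which
  the points at a given distance beyond an edge can be counted. Both follow from an explicit formula for
  the distance in coordinates relative to a root vertex (\<open>tree_dist_eq_rooted_dist\<close>).
\<close>

section \<open>Rooted coordinates on a tree\<close>

definition vertex_point :: "'v \<Rightarrow> 'v \<Rightarrow> real" where
  "vertex_point u = (\<lambda>w. if w = u then 1 else 0)"

lemma vertex_point_eq_iff [simp]: "vertex_point u = vertex_point v \<longleftrightarrow> u = v"
  by (auto simp: vertex_point_def fun_eq_iff split: if_splits)

lemma vertex_edge_point: "edge_point u v 0 = vertex_point u" "u \<noteq> v \<Longrightarrow> edge_point u v 1 = vertex_point v"
  by (auto simp: vertex_point_def edge_point_def)

definition adj :: "'v set set \<Rightarrow> 'v \<Rightarrow> 'v \<Rightarrow> bool" where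
  "adj E u v \<longleftrightarrow> {u, v} \<in> E"

lemma adj_sym: "adj E u v \<Longrightarrow> adj E v u"
  by (simp add: adj_def insert_commute)

lemma walk_rtranclp: "walk E p \<Longrightarrow> (adj E)\<^sup>*\<^sup>* (hd p) (last p)"
proof (induction p)
  case (Cons u p)
  show ?case
  proof (cases p)
    case (Cons v q)
    then have "adj E u v" "walk E p"
      using Cons.prems by (auto simp: walk_def adj_def)
    then show ?thesis
      using Cons.IH Cons by (simp add: converse_rtranclp_into_rtranclp)
  qed simp
qed (simp add: walk_def)

lemma rtrancl_path_walk:
  assumes "rtrancl_path r x xs y" "\<And>u v. r u v \<Longrightarrow> {u, v} \<in> E"
  shows "walk E (x # xs) \<and> last (x # xs) = y"
  using assms by (induction rule: rtrancl_path.induct) (auto simp: walk_def)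

text \<open>
  A detour around an edge, shortened to a path without repeated vertices, still has at least three
  vertices, and the edge closes it to a cycle.
\<close>

lemma tree_no_detour:
  assumes "tree V E" "{a, b} \<in> E"
  shows "\<not> (\<lambda>x y. adj E x y \<and> {x, y} \<noteq> {a, b})\<^sup>*\<^sup>* a b"
proof
  let ?r = "\<lambda>x y. adj E x y \<and> {x, y} \<noteq> {a, b}"
  assume "?r\<^sup>*\<^sup>* a b"
  then obtain xs where "rtrancl_path ?r a xs b"
    by (auto simp: rtranclp_eq_rtrancl_path)
  then obtain ys where ys: "rtrancl_path ?r a ys b" "distinct (a # ys)"
    by (rule rtrancl_path_distinct)
  have ab: "a \<noteq> b"
    using assms simple_graph_edge_neq unfolding tree_def by metis
  have "length ys \<noteq> 0" using ys(1) ab by (auto elim: rtrancl_path.cases)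
  moreover have "length ys \<noteq> 1"
  proof
    assume "length ys = 1"
    then obtain y where "ys = [y]" by (auto simp: length_Suc_conv)
    then show False using ys(1) by (auto elim!: rtrancl_path.cases)
  qed
  ultimately have "3 \<le> length (a # ys)" by (cases ys; cases "tl ys") auto
  moreover have "walk E (a # ys) \<and> last (a # ys) = b"
    using ys(1) by (rule rtrancl_path_walk) (simp add: adj_def)
  ultimately have "cycle E (a # ys)"
    using ys(2) assms(2) by (auto simp: cycle_def insert_commute)
  then show False using assms(1) by (auto simp: tree_def)
qed

locale rooted_tree =
  fixes V :: "'v set" and E :: "'v set set" and root :: 'v
  assumes tree: "tree V E" and root: "root \<in> V"
begin

lemma simple: "simple_graph V E"
  using tree by (simp add: tree_def)

lemma edge_vertices: "adj E u v \<Longrightarrow> u \<in> V \<and> v \<in> V \<and> u \<noteq> v"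
  using simple simple_graph_edge_neq[OF simple] by (auto simp: adj_def simple_graph_def)

definition depth :: "'v \<Rightarrow> nat" where
  "depth v = (LEAST n. (adj E ^^ n) root v)"

text \<open>
  By acyclicity (\<open>edge_parent\<close> below) the neighbour that is one step closer to the root is unique.
\<close>

definition parent :: "'v \<Rightarrow> 'v" where
  "parent v = (SOME u. adj E u v \<and> depth v = Suc (depth u))"

lemma depth_le: "(adj E ^^ n) root v \<Longrightarrow> depth v \<le> n"
  unfolding depth_def by (rule Least_le)

lemma depth_attained:
  assumes "v \<in> V"
  shows "(adj E ^^ depth v) root v"
proof -
  obtain p where "walk E p" "hd p = root" "last p = v"
    using tree root assms unfolding tree_def connected_graph_def by blast
  then have "(adj E)\<^sup>*\<^sup>* root v" using walk_rtranclp by metis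
  then obtain n where "(adj E ^^ n) root v" by (auto simp: rtranclp_is_Sup_relpowp)
  then show ?thesis unfolding depth_def by (rule LeastI)
qed

lemma depth_root [simp]: "depth root = 0"
  using depth_le[of 0 root] by simp

lemma parent:
  assumes "v \<in> V" "v \<noteq> root"
  shows "adj E (parent v) v" "depth v = Suc (depth (parent v))" "parent v \<in> V"
proof -
  have att: "(adj E ^^ depth v) root v" by (rule depth_attained[OF assms(1)])
  with assms(2) have "depth v \<noteq> 0" by (metis relpowp_0_E)
  then obtain n where n: "depth v = Suc n" by (cases "depth v") auto
  then obtain u where u: "(adj E ^^ n) root u" "adj E u v"
    using att by (metis relpowp_Suc_E)
  have "(adj E ^^ Suc (depth u)) root v"
    using depth_attained u(2) edge_vertices relpowp_Suc_I by metis
  then have "depth v \<le> Suc (depth u)" by (rule depth_le)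
  with depth_le[OF u(1)] n have "depth v = Suc (depth u)" by simp
  with u(2) have "\<exists>u. adj E u v \<and> depth v = Suc (depth u)" by blast
  then have *: "adj E (parent v) v \<and> depth v = Suc (depth (parent v))"
    unfolding parent_def by (rule someI_ex)
  then show "adj E (parent v) v" "depth v = Suc (depth (parent v))" by auto
  show "parent v \<in> V" using * edge_vertices by blast
qed

lemma vertex_induct [consumes 1, case_names root child]:
  assumes "v \<in> V" "P root" "\<And>v. v \<in> V \<Longrightarrow> v \<noteq> root \<Longrightarrow> P (parent v) \<Longrightarrow> P v"
  shows "P v"
  using assms(1)
proof (induction "depth v" arbitrary: v)
  case 0
  then show ?case using parent assms(2) by (metis Zero_not_Suc)
next
  case (Suc n)
  then show ?case using parent assms(3) by (metis Suc_inject Zero_not_Suc depth_root)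
qed

text \<open>
  Parent edges alone join both ends of an edge to the root. If the edge were not itself a
  parent edge, climbing from one end to the root and descending to the other would be a detour.
\<close>

lemma edge_parent:
  assumes "adj E a b"
  shows "b \<noteq> root \<and> parent b = a \<or> a \<noteq> root \<and> parent a = b"
proof (rule ccontr)
  assume n: "\<not> ?thesis"
  let ?r = "\<lambda>x y. adj E x y \<and> {x, y} \<noteq> {a, b}"
  have *: "?r\<^sup>*\<^sup>* root v \<and> ?r\<^sup>*\<^sup>* v root" if "v \<in> V" for v
    using that
  proof (induction rule: vertex_induct)
    case (child v)
    have "?r (parent v) v" "?r v (parent v)"
      using parent(1)[OF child(1,2)] n child(2) adj_sym
      by (auto simp: doubleton_eq_iff)
    then show ?case using child(3)
      rtranclp.rtrancl_into_rtrancl[of ?r root "parent v" v]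
      converse_rtranclp_into_rtranclp[of ?r v "parent v" root] by blast
  qed simp
  have "a \<in> V" "b \<in> V" using edge_vertices assms by auto
  with * have "?r\<^sup>*\<^sup>* a root" "?r\<^sup>*\<^sup>* root b" by blast+
  then have "?r\<^sup>*\<^sup>* a b" by (rule rtranclp_trans)
  then show False using tree_no_detour[OF tree] assms by (simp add: adj_def)
qed

definition anc :: "'v \<Rightarrow> nat \<Rightarrow> 'v" where
  "anc v k = (parent ^^ (depth v - k)) v"

lemma anc_depth [simp]: "anc v (depth v) = v"
  by (simp add: anc_def)

lemma anc_parent:
  assumes "v \<in> V" "v \<noteq> root" "k < depth v"
  shows "anc v k = anc (parent v) k"
proof -
  have "depth v - k = Suc (depth (parent v) - k)" using parent(2)[OF assms(1,2)] assms(3) by simp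
  then show ?thesis by (simp add: anc_def funpow_swap1)
qed

lemma anc_vertex: "v \<in> V \<Longrightarrow> k \<le> depth v \<Longrightarrow> anc v k \<in> V \<and> depth (anc v k) = k"
proof (induction rule: vertex_induct)
  case root then show ?case using rooted_tree.root[OF rooted_tree_axioms] by (simp add: anc_def)
next
  case (child v)
  show ?case
  proof (cases "k = depth v")
    case True then show ?thesis using child(1) by simp
  next
    case False
    then have "k < depth v" using child(4) by simp
    then show ?thesis using child anc_parent parent(2)[OF child(1,2)] by simp
  qed
qed

lemma anc_anc: "v \<in> V \<Longrightarrow> k \<le> depth v \<Longrightarrow> j \<le> k \<Longrightarrow> anc (anc v k) j = anc v j"
proof (induction rule: vertex_induct)
  case root then show ?case by (simp add: anc_def)
next
  case (child v)
  show ?case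
  proof (cases "k = depth v")
    case True then show ?thesis by simp
  next
    case False
    then have "k < depth v" using child(4) by simp
    then show ?thesis using child anc_parent parent(2)[OF child(1,2)] by simp
  qed
qed

text \<open>
  The depth of the last common vertex of the paths from the root to \<open>u\<close> and to \<open>v\<close>. On vertices this is
  the Gromov product based at the root.
\<close>

definition common_depth :: "'v \<Rightarrow> 'v \<Rightarrow> nat" where
  "common_depth u v = Max {k. k \<le> depth u \<and> k \<le> depth v \<and> anc u k = anc v k}"

lemma anc_0: "v \<in> V \<Longrightarrow> anc v 0 = root"
  using anc_vertex[of v 0] parent(2)[of "anc v 0"] by fastforce

lemma le_common_depth_iff:
  assumes "u \<in> V" "v \<in> V"
  shows "k \<le> common_depth u v \<longleftrightarrow> k \<le> depth u \<and> k \<le> depth v \<and> anc u k = anc v k"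
proof -
  let ?S = "{k. k \<le> depth u \<and> k \<le> depth v \<and> anc u k = anc v k}"
  have fin: "finite ?S" by (rule finite_subset[of _ "{..depth u}"]) auto
  have "0 \<in> ?S" using anc_0 assms by simp
  then have mem: "common_depth u v \<in> ?S" unfolding common_depth_def using fin by (intro Max_in) auto
  show ?thesis
  proof
    assume k: "k \<le> common_depth u v"
    moreover have "anc u k = anc (anc u (common_depth u v)) k" "anc v k = anc (anc v (common_depth u v)) k"
      using mem anc_anc[of u "common_depth u v" k] anc_anc[of v "common_depth u v" k] assms k by auto
    ultimately have "anc u k = anc v k" using mem by simp
    then show "k \<le> depth u \<and> k \<le> depth v \<and> anc u k = anc v k" using k mem by auto
  next
    assume "k \<le> depth u \<and> k \<le> depth v \<and> anc u k = anc v k"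
    then show "k \<le> common_depth u v" unfolding common_depth_def using fin by (intro Max_ge) auto
  qed
qed

lemma common_depth_le: "u \<in> V \<Longrightarrow> v \<in> V \<Longrightarrow> common_depth u v \<le> depth u \<and> common_depth u v \<le> depth v"
  and anc_common_depth: "u \<in> V \<Longrightarrow> v \<in> V \<Longrightarrow> anc u (common_depth u v) = anc v (common_depth u v)"
  using le_common_depth_iff[of u v "common_depth u v"] by auto

lemma common_depth_sym: "common_depth u v = common_depth v u"
  unfolding common_depth_def by (rule arg_cong[where f = Max]) auto

lemma common_depth_self: "u \<in> V \<Longrightarrow> common_depth u u = depth u"
  using le_common_depth_iff[of u u "depth u"] common_depth_le[of u u] by simp

text \<open>
  Having the same ancestor at depth \<open>k\<close> is transitive, and it is inherited by smaller depths. This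
  ultrametric inequality is the source of the four-point condition.
\<close>

lemma common_depth_ultra:
  assumes "u \<in> V" "v \<in> V" "w \<in> V"
  shows "min (common_depth u v) (common_depth v w) \<le> common_depth u w"
proof -
  let ?k = "min (common_depth u v) (common_depth v w)"
  have "?k \<le> common_depth u v" "?k \<le> common_depth v w" by auto
  then show ?thesis using assms by (simp only: le_common_depth_iff)
qed

lemma common_depth_parent:
  assumes "v \<in> V" "w \<in> V" "w \<noteq> root"
  shows "common_depth v (parent w) = min (common_depth v w) (depth w - 1)"
proof -
  note p = parent[OF assms(2,3)]
  have "k \<le> common_depth v (parent w) \<longleftrightarrow> k \<le> min (common_depth v w) (depth w - 1)" for k
    using p anc_parent[OF assms(2,3), of k] by (auto simp: le_common_depth_iff assms p(3) min_le_iff_disj)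
  then show ?thesis by (metis order_antisym order_refl)
qed

subsection \<open>Points in rooted coordinates\<close>

text \<open>
  Every edge joins a vertex \<open>v\<close> to its parent, so all points of the metric tree are of this form. The
  coordinates are not unique: a vertex is the point \<open>t = 1\<close> of its own edge and the point \<open>t = 0\<close> of the edge
  of each of its children.
\<close>

definition rooted_point :: "'v \<Rightarrow> real \<Rightarrow> 'v \<Rightarrow> real" where
  "rooted_point v t = edge_point (parent v) v t"

definition level :: "'v \<Rightarrow> real \<Rightarrow> real" where
  "level v t = real (depth v) - 1 + t"

text \<open>
  The Gromov product based at the root. Cutting the common depth off at both levels matters when
  one of the points lies on the path from the root to the other.
\<close>

definition meet :: "'v \<Rightarrow> real \<Rightarrow> 'v \<Rightarrow> real \<Rightarrow> real" where
  "meet v t w s = min (min (level v t) (level w s)) (real (common_depth v w))"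

definition rooted_dist :: "'v \<Rightarrow> real \<Rightarrow> 'v \<Rightarrow> real \<Rightarrow> real" where
  "rooted_dist v t w s = level v t + level w s - 2 * meet v t w s"

definition proper :: "'v \<Rightarrow> bool" where
  "proper v \<longleftrightarrow> v \<in> V \<and> v \<noteq> root"

lemma properD:
  assumes "proper v"
  shows "v \<in> V" "parent v \<in> V" "{parent v, v} \<in> E" "depth v = Suc (depth (parent v))" "parent v \<noteq> v"
  using parent[of v] assms edge_vertices[of "parent v" v] by (auto simp: proper_def adj_def)

lemma edge_cases:
  assumes "{u, v} \<in> E"
  obtains (down) "proper v" "u = parent v" "edge_point u v = rooted_point v"
  | (up) "proper u" "v = parent u" "\<And>s. edge_point u v s = rooted_point u (1 - s)"
proof -
  have "adj E u v" using assms by (simp add: adj_def)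
  note * = edge_vertices[OF this] edge_parent[OF this]
  then consider "proper v" "u = parent v" | "proper u" "v = parent u"
    by (auto simp: proper_def)
  then show ?thesis
  proof cases
    case 1 then have "edge_point u v = rooted_point v" by (simp add: rooted_point_def fun_eq_iff)
    then show ?thesis using 1 down by blast
  next
    case 2
    then have "edge_point u v s = rooted_point u (1 - s)" for s
      using * edge_point_swap[of u v s] by (simp add: rooted_point_def)
    then show ?thesis using up 2 by auto
  qed
qed

lemma metric_tree_rooted_point:
  assumes "x \<in> metric_tree E"
  obtains v t where "x = rooted_point v t" "proper v" "t \<in> {0..1}"
proof -
  obtain u v s where x: "x = edge_point u v s" "{u, v} \<in> E" "s \<in> {0..1}"
    using assms by (auto simp: metric_tree_def)
  show ?thesis
    using x(2) by (cases rule: edge_cases) (use x that in auto)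
qed

lemma rooted_point_in: "proper v \<Longrightarrow> t \<in> {0..1} \<Longrightarrow> rooted_point v t \<in> metric_tree E"
  using properD[of v] by (auto simp: rooted_point_def)

lemma rooted_point_0: "rooted_point v 0 = vertex_point (parent v)"
  by (auto simp: rooted_point_def vertex_point_def edge_point_def)

lemma rooted_point_1: "proper v \<Longrightarrow> rooted_point v 1 = vertex_point v"
  using properD(5)[of v] by (auto simp: rooted_point_def vertex_point_def edge_point_def fun_eq_iff)

definition rooted_dist_vertex :: "'v \<Rightarrow> real \<Rightarrow> 'v \<Rightarrow> real" where
  "rooted_dist_vertex v t u = level v t + real (depth u) - 2 * min (level v t) (real (common_depth v u))"

lemma rooted_dist_0:
  assumes "proper v" "proper w"
  shows "rooted_dist v t w 0 = rooted_dist_vertex v t (parent w)"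
  using common_depth_parent[of v w] properD[OF assms(1)] properD[OF assms(2)] assms(2)
  by (auto simp: rooted_dist_def rooted_dist_vertex_def level_def meet_def proper_def min_def)

lemma rooted_dist_1:
  assumes "proper v" "proper w"
  shows "rooted_dist v t w 1 = rooted_dist_vertex v t w"
  using common_depth_le[of v w] properD(1)[OF assms(1)] properD(1)[OF assms(2)]
  by (auto simp: rooted_dist_def rooted_dist_vertex_def level_def meet_def min_def)

lemma rooted_point_support: "proper v \<Longrightarrow> 0 < t \<Longrightarrow> t < 1 \<Longrightarrow> {w. rooted_point v t w \<noteq> 0} = {parent v, v}"
  using properD(5)[of v] by (auto simp: rooted_point_def edge_point_def)

lemma vertex_point_support: "{w. vertex_point v w \<noteq> 0} = {v}"
  by (auto simp: vertex_point_def)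

text \<open>
  Coordinates are unique except at vertices, and there the value is expressed by
  \<open>rooted_dist_vertex\<close>, which depends on the vertex only. Interior points are told from vertices by the number
  of their nonzero barycentric coordinates.
\<close>

lemma rooted_dist_cong:
  assumes "proper v" "proper w" "proper w'" "s \<in> {0..1}" "s' \<in> {0..1}" "rooted_point w s = rooted_point w' s'"
  shows "rooted_dist v t w s = rooted_dist v t w' s'"
proof -
  note P = properD[OF assms(2)] properD[OF assms(3)]
  have end_cases: "s = 0 \<or> s = 1 \<or> 0 < s \<and> s < 1" "s' = 0 \<or> s' = 1 \<or> 0 < s' \<and> s' < 1"
    using assms(4,5) by auto
  show ?thesis
  proof (cases "0 < s \<and> s < 1 \<or> 0 < s' \<and> s' < 1")
    case True
    have c: "card {a. rooted_point w s a \<noteq> 0} = (if 0 < s \<and> s < 1 then 2 else 1)"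
      using end_cases(1) rooted_point_support[OF assms(2), of s] P rooted_point_0 rooted_point_1[OF assms(2)] by (auto simp: vertex_point_support)
    have c': "card {a. rooted_point w' s' a \<noteq> 0} = (if 0 < s' \<and> s' < 1 then 2 else 1)"
      using end_cases(2) rooted_point_support[OF assms(3), of s'] P rooted_point_0 rooted_point_1[OF assms(3)] by (auto simp: vertex_point_support)
    have both: "0 < s \<and> s < 1" "0 < s' \<and> s' < 1"
      using True c c' assms(6) by (auto split: if_splits)
    then have "{parent w, w} = {parent w', w'}"
      using rooted_point_support[OF assms(2), of s] rooted_point_support[OF assms(3), of s'] assms(6) by simp
    then have "w = w'" using P by (auto simp: doubleton_eq_iff)
    moreover from this have "s = s'"
      using fun_cong[OF assms(6), of w] P by (simp add: rooted_point_def edge_point_def split: if_splits)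
    ultimately show ?thesis by simp
  next
    case False
    then show ?thesis
      using end_cases assms(2,6)
      by (auto simp: rooted_point_0 rooted_point_1 rooted_dist_0 rooted_dist_1 assms(1,3))
  qed
qed

lemma rooted_dist_self: "proper v \<Longrightarrow> t \<in> {0..1} \<Longrightarrow> rooted_dist v t v t = 0"
  using common_depth_self[of v] properD(1)[of v] by (auto simp: rooted_dist_def meet_def level_def)

text \<open>
  The level \<open>l\<close> of the second point enters only as \<open>\<bar>l - C\<bar> - C\<close>, where \<open>C\<close> does not depend on its
  position \<open>s\<close> on the edge.
\<close>

lemma rooted_dist_lipschitz: "rooted_dist v t w s' \<le> rooted_dist v t w s + \<bar>s - s'\<bar>"
  by (auto simp: rooted_dist_def meet_def level_def min_def abs_if)

text \<open>
  Each segment of a chain stays on one edge, where the formula is 1-Lipschitz.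
\<close>

lemma rooted_dist_le_chain:
  assumes "chain E x y l" "x = rooted_point v t" "proper v" "t \<in> {0..1}"
  shows "\<And>w s. y = rooted_point w s \<Longrightarrow> proper w \<Longrightarrow> s \<in> {0..1} \<Longrightarrow> rooted_dist v t w s \<le> l"
  using assms(1)
proof (induction rule: chain.induct)
  case refl
  then show ?case
    using rooted_dist_cong[of v w v s t t] rooted_dist_self assms by simp
next
  case (step a b s1 l s2)
  have "\<exists>w' r1 r2. proper w' \<and> r1 \<in> {0..1} \<and> r2 \<in> {0..1} \<and> edge_point a b s1 = rooted_point w' r1 \<and>
    edge_point a b s2 = rooted_point w' r2 \<and> \<bar>r1 - r2\<bar> = \<bar>s1 - s2\<bar>"
    using step.hyps(2)
  proof (cases rule: edge_cases)
    case down
    then show ?thesis using step.hyps by auto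
  next
    case up
    then show ?thesis using step.hyps
      by (intro exI[of _ a] exI[of _ "1 - s1"] exI[of _ "1 - s2"]) auto
  qed
  then obtain w' r1 r2 where w': "proper w'" "r1 \<in> {0..1}" "r2 \<in> {0..1}"
    "edge_point a b s1 = rooted_point w' r1" "edge_point a b s2 = rooted_point w' r2" "\<bar>r1 - r2\<bar> = \<bar>s1 - s2\<bar>"
    by blast
  have "rooted_dist v t w s = rooted_dist v t w' r2"
    using rooted_dist_cong[OF assms(3) step.prems(2) w'(1) step.prems(3) w'(3)] step.prems(1) w'(5) by simp
  also have "\<dots> \<le> rooted_dist v t w' r1 + \<bar>r1 - r2\<bar>" by (rule rooted_dist_lipschitz)
  also have "\<dots> \<le> l + \<bar>s1 - s2\<bar>" using step.IH[OF w'(4,1,2)] w'(6) by simp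
  finally show ?case .
qed

lemma chain_anc:
  "v \<in> V \<Longrightarrow> k \<le> depth v \<Longrightarrow> vertex_point v \<in> metric_tree E \<Longrightarrow> chain E (vertex_point v) (vertex_point (anc v k)) (real (depth v) - real k)"
proof (induction rule: vertex_induct)
  case root then show ?case using chain.refl by (simp add: anc_def)
next
  case (child v)
  then have pr: "proper v" by (simp add: proper_def)
  note P = properD[OF pr]
  show ?case
  proof (cases "k = depth v")
    case True then show ?thesis using chain.refl child by simp
  next
    case False
    then have k: "k < depth v" using child(4) by simp
    have "chain E (vertex_point v) (vertex_point (parent v)) 1"
      using chain_segment[OF P(3), of 1 0] rooted_point_0[of v] rooted_point_1[OF pr] by (simp add: rooted_point_def)
    moreover have "chain E (vertex_point (parent v)) (vertex_point (anc (parent v) k)) (real (depth (parent v)) - real k)"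
      using child.IH k P calculation chain_in_metric_tree by auto
    ultimately have "chain E (vertex_point v) (vertex_point (anc v k)) (1 + (real (depth (parent v)) - real k))"
      unfolding anc_parent[OF child(1,2) k] by (rule chain_trans)
    then show ?thesis using P(4) by (simp add: add_diff_eq)
  qed
qed

lemma chain_down:
  assumes v: "proper v" "t \<in> {0..1}" and k: "k < depth v"
  shows "chain E (vertex_point (anc v k)) (rooted_point v t) (level v t - k)"
proof -
  note P = properD[OF v(1)]
  have 1: "chain E (vertex_point (parent v)) (rooted_point v t) t"
    using chain_segment[OF P(3), of 0 t] v rooted_point_0[of v] by (simp add: rooted_point_def)
  have "vertex_point (parent v) \<in> metric_tree E" using chain_in_metric_tree[OF 1] by simp
  then have "chain E (vertex_point (parent v)) (vertex_point (anc v k)) (real (depth (parent v)) - real k)"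
    using chain_anc[OF P(2), of k] k P(4) anc_parent[of v k] v by (simp add: proper_def)
  from chain_trans[OF chain_sym[OF this] 1] show ?thesis
    using P(4) by (simp add: level_def algebra_simps)
qed

lemma chain_descend:
  assumes v: "proper v" "t \<in> {0..1}" and w: "proper w" "s \<in> {0..1}"
    and ne: "v \<noteq> w" and c: "common_depth v w = depth v"
  shows "chain E (rooted_point v t) (rooted_point w s) (rooted_dist v t w s)"
proof -
  note V = properD(1)[OF v(1)] and W = properD(1)[OF w(1)]
  have "depth v \<le> depth w" using common_depth_le[OF V W] c by simp
  moreover have vw: "anc w (depth v) = v" using anc_common_depth[OF V W] c by simp
  ultimately have lt: "depth v < depth w" using ne by (cases "depth v = depth w") auto
  have 1: "chain E (rooted_point v t) (vertex_point v) (1 - t)"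
    using chain_segment[OF properD(3)[OF v(1)], of t 1] v rooted_point_1[OF v(1)] by (simp add: rooted_point_def)
  have 2: "chain E (vertex_point v) (rooted_point w s) (level w s - depth v)"
    using chain_down[OF w lt] vw by simp
  have "level v t \<le> depth v" "depth v \<le> level w s" using lt v w by (auto simp: level_def)
  then have "rooted_dist v t w s = (1 - t) + (level w s - depth v)"
    using c by (simp add: rooted_dist_def meet_def level_def min_def)
  then show ?thesis using chain_trans[OF 1 2] by simp
qed

lemma rooted_dist_sym: "rooted_dist v t w s = rooted_dist w s v t"
  by (simp add: rooted_dist_def meet_def common_depth_sym[of v w] min.commute)

text \<open>
  Climbing from each point to the last common vertex gives a chain of exactly this length, so the
  infimum that defines the distance is attained.
\<close>

lemma chain_rooted_dist:
  assumes v: "proper v" "t \<in> {0..1}" and w: "proper w" "s \<in> {0..1}"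
  shows "chain E (rooted_point v t) (rooted_point w s) (rooted_dist v t w s)"
proof -
  note V = properD(1)[OF v(1)] and W = properD(1)[OF w(1)]
  note le = common_depth_le[OF V W]
  consider "v = w" | "v \<noteq> w" "common_depth v w = depth v" | "v \<noteq> w" "common_depth v w = depth w"
    | "common_depth v w < depth v" "common_depth v w < depth w" using le by linarith
  then show ?thesis
  proof cases
    case 1
    have "rooted_dist v t v s = \<bar>t - s\<bar>"
      using v w common_depth_self[OF V] by (auto simp: rooted_dist_def meet_def level_def min_def abs_if)
    then show ?thesis
      using chain_segment[OF properD(3)[OF v(1)] v(2) w(2)] 1 by (simp add: rooted_point_def)
  next
    case 2 then show ?thesis using chain_descend assms by blast
  next
    case 3 then show ?thesis
      using chain_sym[OF chain_descend[OF w v]] common_depth_sym[of v w] rooted_dist_sym by simp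
  next
    case 4
    have "chain E (rooted_point v t) (vertex_point (anc v (common_depth v w))) (level v t - common_depth v w)"
      by (rule chain_sym[OF chain_down[OF v 4(1)]])
    moreover have "chain E (vertex_point (anc v (common_depth v w))) (rooted_point w s) (level w s - common_depth v w)"
      using chain_down[OF w 4(2)] anc_common_depth[OF V W] by simp
    ultimately have "chain E (rooted_point v t) (rooted_point w s) (level v t - common_depth v w + (level w s - common_depth v w))"
      by (rule chain_trans)
    moreover have "real (common_depth v w) \<le> level v t" "real (common_depth v w) \<le> level w s"
      using 4 v w by (auto simp: level_def)
    ultimately have "chain E (rooted_point v t) (rooted_point w s) (level v t - common_depth v w + (level w s - common_depth v w))"
      "rooted_dist v t w s = level v t - common_depth v w + (level w s - common_depth v w)"
      by (auto simp: rooted_dist_def meet_def)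
    then show ?thesis by simp
  qed
qed

theorem tree_dist_eq_rooted_dist:
  assumes v: "proper v" "t \<in> {0..1}" and w: "proper w" "s \<in> {0..1}"
  shows "tree_dist E (rooted_point v t) (rooted_point w s) = rooted_dist v t w s"
proof (rule antisym)
  show "tree_dist E (rooted_point v t) (rooted_point w s) \<le> rooted_dist v t w s"
    by (rule tree_dist_le[OF simple chain_rooted_dist[OF assms]])
  show "rooted_dist v t w s \<le> tree_dist E (rooted_point v t) (rooted_point w s)"
    using rooted_dist_le_chain[OF _ HOL.refl v HOL.refl w] assms
    by (intro tree_dist_greatest[OF tree]) (auto intro: rooted_point_in)
qed

lemma meet_sym: "meet v t w s = meet w s v t"
  by (simp add: meet_def common_depth_sym[of v w] min.commute)

lemma meet_ultra:
  assumes "proper u" "proper v" "proper w"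
  shows "min (meet u r v s) (meet v s w t) \<le> meet u r w t"
  using common_depth_ultra[of u v w] properD(1)[OF assms(1)] properD(1)[OF assms(2)] properD(1)[OF assms(3)]
  by (auto simp: meet_def min_def split: if_splits)

text \<open>
  With base point the root, the four-point condition is an inequality between sums of two Gromov
  products, and it holds for every ultrametric family of products.
\<close>

theorem tree_dist_four_point:
  assumes "a \<in> metric_tree E" "b \<in> metric_tree E" "x \<in> metric_tree E" "y \<in> metric_tree E"
  shows "tree_dist E a b + tree_dist E x y \<le>
    max (tree_dist E a x + tree_dist E b y) (tree_dist E a y + tree_dist E b x)"
proof -
  obtain va ta where a: "a = rooted_point va ta" "proper va" "ta \<in> {0..1}"
    using metric_tree_rooted_point[OF assms(1)] by blast
  obtain vb tb where b: "b = rooted_point vb tb" "proper vb" "tb \<in> {0..1}"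
    using metric_tree_rooted_point[OF assms(2)] by blast
  obtain vx tx where x: "x = rooted_point vx tx" "proper vx" "tx \<in> {0..1}"
    using metric_tree_rooted_point[OF assms(3)] by blast
  obtain vy ty where y: "y = rooted_point vy ty" "proper vy" "ty \<in> {0..1}"
    using metric_tree_rooted_point[OF assms(4)] by blast
  let ?ab = "meet va ta vb tb" and ?xy = "meet vx tx vy ty" and ?ax = "meet va ta vx tx"
    and ?by = "meet vb tb vy ty" and ?ay = "meet va ta vy ty" and ?bx = "meet vb tb vx tx"
  note u = meet_ultra[OF a(2) x(2) b(2), of ta tx tb] meet_ultra[OF a(2) y(2) b(2), of ta ty tb]
    meet_ultra[OF x(2) a(2) y(2), of tx ta ty] meet_ultra[OF x(2) b(2) y(2), of tx tb ty]
  have "min (?ax + ?by) (?ay + ?bx) \<le> ?ab + ?xy"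
    using u meet_sym[of vx tx vb tb] meet_sym[of vy ty vb tb] meet_sym[of vx tx va ta] by linarith
  then show ?thesis
    using a b x y by (simp add: tree_dist_eq_rooted_dist rooted_dist_def)
qed

lemma tree_dist_attained:
  assumes "x \<in> metric_tree E" "y \<in> metric_tree E"
  shows "chain E x y (tree_dist E x y)"
  using chain_rooted_dist tree_dist_eq_rooted_dist assms metric_tree_rooted_point by metis

text \<open>
  Common depths are integers, so a path to a point off the edge cannot branch off at an interior point
  of the edge: its meet with the edge is at one of the two ends.
\<close>

lemma edge_dichotomy_proper:
  assumes v: "proper v" and x: "x \<in> metric_tree E"
  shows "(\<exists>t\<in>{0..1}. x = rooted_point v t) \<or> tree_dist E (rooted_point v 0) x = 1 + tree_dist E (rooted_point v 1) x
    \<or> tree_dist E (rooted_point v 1) x = 1 + tree_dist E (rooted_point v 0) x"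
proof -
  obtain a s where a: "x = rooted_point a s" "proper a" "s \<in> {0..1}"
    using metric_tree_rooted_point[OF x] by blast
  show ?thesis
  proof (cases "a = v")
    case False
    note V = properD(1)[OF v] and A = properD(1)[OF a(2)]
    have "depth v < depth a" if "common_depth v a = depth v"
    proof -
      have "anc a (depth v) = v" using anc_common_depth[OF V A] that by simp
      then have "depth v \<noteq> depth a" using False by auto
      then show ?thesis using common_depth_le[OF V A] that by simp
    qed
    then have "real (common_depth v a) = depth v \<and> depth v \<le> level a s \<or> real (common_depth v a) \<le> real (depth v) - 1"
      using common_depth_le[OF V A] a(3) by (cases "common_depth v a = depth v") (auto simp: level_def)
    then have "rooted_dist v 0 a s = 1 + rooted_dist v 1 a s \<or> rooted_dist v 1 a s = 1 + rooted_dist v 0 a s"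
      by (auto simp: rooted_dist_def meet_def level_def min_def)
    then show ?thesis using a v by (simp add: tree_dist_eq_rooted_dist)
  qed (use a in auto)
qed

theorem edge_dichotomy:
  assumes "{u, v} \<in> E" and "x \<in> metric_tree E"
  shows "(\<exists>t\<in>{0..1}. x = edge_point u v t) \<or> tree_dist E (vertex_point u) x = 1 + tree_dist E (vertex_point v) x
    \<or> tree_dist E (vertex_point v) x = 1 + tree_dist E (vertex_point u) x"
proof (rule edge_cases[OF assms(1)])
  assume down: "proper v" "u = parent v" "edge_point u v = rooted_point v"
  then show ?thesis using edge_dichotomy_proper[OF down(1) assms(2)] by (auto simp: rooted_point_0 rooted_point_1)
next
  assume up: "proper u" "v = parent u" "\<And>s. edge_point u v s = rooted_point u (1 - s)"
  have "\<exists>t'\<in>{0..1}. rooted_point u t = edge_point u v t'" if "t \<in> {0..1}" for t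
    using that up(3)[of "1 - t"] by (intro bexI[of _ "1 - t"]) auto
  then have "(\<exists>t\<in>{0..1}. x = rooted_point u t) \<Longrightarrow> \<exists>t\<in>{0..1}. x = edge_point u v t" by blast
  then show ?thesis
    using edge_dichotomy_proper[OF up(1) assms(2)] rooted_point_0[of u] rooted_point_1[OF up(1)] up(2) by auto
qed

end

section \<open>Geodesics of the metric tree\<close>

lemma tree_root: "tree V E \<Longrightarrow> \<exists>r. rooted_tree V E r"
  by (auto simp: tree_def connected_graph_def rooted_tree_def)

text \<open>
  Cutting a chain of minimal length gives the points of a geodesic.
\<close>

lemma chain_split:
  assumes "chain E x y l" "0 \<le> a" "a \<le> l"
  shows "\<exists>p. chain E x p a \<and> chain E p y (l - a)"
  using assms
proof (induction arbitrary: a rule: chain.induct)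
  case refl
  then show ?case using chain.refl by auto
next
  case (step u v s l t)
  show ?case
  proof (cases "a \<le> l")
    case True
    then obtain p where "chain E x p a" "chain E p (edge_point u v s) (l - a)"
      using step by blast
    moreover from this chain.step[OF this(2) step.hyps(2-4)]
    have "chain E p (edge_point u v t) (l + \<bar>s - t\<bar> - a)" by (simp add: algebra_simps)
    ultimately show ?thesis by blast
  next
    case False
    define r where "r = (if s \<le> t then s + (a - l) else s - (a - l))"
    have r: "r \<in> {0..1}" "\<bar>s - r\<bar> = a - l" "\<bar>r - t\<bar> = l + \<bar>s - t\<bar> - a"
      using step.hyps step.prems False by (auto simp: r_def)
    have "chain E x (edge_point u v r) a"
      using chain.step[OF step.hyps(1-3) r(1)] r(2) by simp
    moreover have "chain E (edge_point u v r) (edge_point u v t) (l + \<bar>s - t\<bar> - a)"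
      using chain_segment[OF step.hyps(2) r(1) step.hyps(4)] r(3) by simp
    ultimately show ?thesis by blast
  qed
qed

theorem tree_dist_geodesic:
  assumes "tree V E" "x \<in> metric_tree E" "y \<in> metric_tree E" "0 \<le> a" "a \<le> tree_dist E x y"
  shows "\<exists>p\<in>metric_tree E. tree_dist E x p = a \<and> tree_dist E p y = tree_dist E x y - a"
proof -
  interpret Metric_space "metric_tree E" "tree_dist E" by (rule Metric_space_metric_tree[OF assms(1)])
  have sg: "simple_graph V E" using assms(1) by (simp add: tree_def)
  obtain r where "rooted_tree V E r" using tree_root[OF assms(1)] by blast
  then have "chain E x y (tree_dist E x y)" using rooted_tree.tree_dist_attained assms by metis
  from chain_split[OF this assms(4,5)] obtain p
    where p: "chain E x p a" "chain E p y (tree_dist E x y - a)" by blast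
  have P: "p \<in> metric_tree E" using chain_in_metric_tree[OF p(1)] by simp
  have "tree_dist E x p \<le> a" "tree_dist E p y \<le> tree_dist E x y - a"
    using tree_dist_le[OF sg] p by blast+
  moreover have "tree_dist E x y \<le> tree_dist E x p + tree_dist E p y"
    using triangle assms P by blast
  ultimately show ?thesis using P by (intro bexI[of _ p]) auto
qed


section \<open>Geodesic spaces satisfying the four-point condition\<close>

text \<open>
  A substitute for the intermediate value theorem: \<open>P\<close> will say on which side of a point the value of a
  discontinuous map lies.
\<close>

lemma discrete_crossing:
  fixes P :: "real \<Rightarrow> bool"
  assumes "0 \<le> L" "\<not> P 0" "P L" "0 < \<eta>"
  shows "\<exists>s\<in>{0..L}. \<exists>t\<in>{0..L}. \<bar>s - t\<bar> \<le> \<eta> \<and> \<not> P s \<and> P t"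
proof -
  obtain n :: nat where n: "L / \<eta> < real n" using reals_Archimedean2 by blast
  then have n0: "0 < n" using assms by (cases n) (auto simp: divide_less_0_iff)
  have step: "L / n \<le> \<eta>" using n n0 assms by (simp add: field_simps)
  define k where "k = (LEAST k. P (real k * (L / n)))"
  have "P (real n * (L / n))" using assms(3) n0 by simp
  then have k: "P (real k * (L / n))" "k \<le> n"
    unfolding k_def by (rule LeastI, rule Least_le)
  have "k \<noteq> 0" using k(1) assms(2) by (metis mult_zero_left of_nat_0)
  then obtain j where j: "k = Suc j" by (cases k) auto
  then have nj: "\<not> P (real j * (L / n))"
    using not_less_Least[of j "\<lambda>k. P (real k * (L / n))"] by (simp add: k_def)
  have in_range: "real i * (L / n) \<in> {0..L}" if "i \<le> n" for i
  proof -
    have "real i * L \<le> real n * L" using that assms(1) by (intro mult_right_mono) auto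
    then show ?thesis using assms(1) n0 by (simp add: field_simps)
  qed
  have "\<bar>real j * (L / n) - real k * (L / n)\<bar> = L / n"
    using assms(1) by (simp add: j distrib_right del: times_divide_eq_right)
  then show ?thesis
    using in_range[of j] in_range[of k] j k nj step by (metis Suc_leD)
qed

locale zero_hyperbolic = Metric_space M d for M :: "'a set" and d +
  assumes four_point: "\<lbrakk>a \<in> M; b \<in> M; x \<in> M; y \<in> M\<rbrakk> \<Longrightarrow>
      d a b + d x y \<le> max (d a x + d b y) (d a y + d b x)"
    and geodesic: "\<lbrakk>x \<in> M; y \<in> M; 0 \<le> t; t \<le> d x y\<rbrakk> \<Longrightarrow> \<exists>p\<in>M. d x p = t \<and> d p y = d x y - t"
begin

definition between :: "'a \<Rightarrow> 'a \<Rightarrow> 'a \<Rightarrow> bool" where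
  "between x q y \<longleftrightarrow> d x y = d x q + d q y"

definition gromov_product :: "'a \<Rightarrow> 'a \<Rightarrow> 'a \<Rightarrow> real" where
  "gromov_product x a b = (d x a + d x b - d a b) / 2"

text \<open>
  Removing \<open>q\<close> separates \<open>a\<close> from \<open>b\<close>, and \<open>c\<close> is separated from at least one of them.
\<close>

lemma tripod:
  assumes "between a q b" "a \<in> M" "b \<in> M" "c \<in> M" "q \<in> M"
  shows "between a q c \<or> between c q b"
  using four_point[of a b c q] triangle[of a q c] triangle[of c q b] assms
    commute[of b q] commute[of b c] commute[of c q]
  unfolding between_def by linarith

lemma between_sym: "between x q y \<Longrightarrow> between y q x"
  using commute[of x y] commute[of x q] commute[of q y] by (simp add: between_def)

lemma between_extend:
  assumes "between x z a" "between x a g" "x \<in> M" "z \<in> M" "a \<in> M" "g \<in> M"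
  shows "between x z g"
  using assms triangle[of z a g] triangle[of x z g] unfolding between_def by linarith

lemma segment_dist:
  assumes "between u p v" "between u q v" "u \<in> M" "v \<in> M" "p \<in> M" "q \<in> M"
  shows "d p q \<le> \<bar>d u p - d u q\<bar>"
  using four_point[of p q u v] assms commute[of p u] commute[of q v] commute[of q u] commute[of p v]
  unfolding between_def by (simp add: max_def abs_if split: if_splits)

lemma segment_order:
  assumes "between u p v" "between u q v" "d u p \<le> d u q" "u \<in> M" "v \<in> M" "p \<in> M" "q \<in> M"
  shows "between u p q"
  using segment_dist[OF assms(1,2,4-7)] assms triangle[of u p q] unfolding between_def by linarith

lemma gromov_product_ultra:
  assumes "x \<in> M" "a \<in> M" "b \<in> M" "c \<in> M"
  shows "min (gromov_product x a b) (gromov_product x b c) \<le> gromov_product x a c"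
  using four_point[of a c x b] assms commute[of a x] commute[of c x] commute[of c b]
  unfolding gromov_product_def by (auto simp: max_def min_def split: if_splits)

lemma gromov_product_le_segment:
  assumes "between a q b" "x \<in> M" "a \<in> M" "b \<in> M" "q \<in> M"
  shows "gromov_product x a b \<le> d x q"
  using assms triangle[of x q a] triangle[of x q b] commute[of q a]
  unfolding between_def gromov_product_def by (simp add: field_simps)

text \<open>
  In a tree the Gromov product based at \<open>x\<close> is the distance from \<open>x\<close> to the geodesic between \<open>a\<close> and \<open>b\<close>.
\<close>

lemma projection:
  assumes "x \<in> M" "a \<in> M" "b \<in> M"
  shows "\<exists>q\<in>M. between a q b \<and> d x q = gromov_product x a b"
proof -
  have "0 \<le> gromov_product a x b" "gromov_product a x b \<le> d a b"
    using triangle[of x a b] triangle[of a b x] assms commute[of x a] commute[of x b]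
    by (auto simp: gromov_product_def)
  then obtain q where q: "q \<in> M" "d a q = gromov_product a x b" "d q b = d a b - gromov_product a x b"
    using geodesic[of a b] assms by blast
  have "d x q = gromov_product x a b"
    using four_point[of x q a b] triangle[of x q a] assms q commute[of q a] commute[of x a]
    unfolding gromov_product_def by argo
  then show ?thesis using q by (intro bexI[of _ q]) (auto simp: between_def)
qed

subsection \<open>Quasi-isometries into the space\<close>

definition geodesically_convex :: "'a set \<Rightarrow> bool" where
  "geodesically_convex B \<longleftrightarrow> B \<subseteq> M \<and> (\<forall>u\<in>B. \<forall>v\<in>B. \<forall>p\<in>M. between u p v \<longrightarrow> p \<in> B)"

lemma mcball_convex: "geodesically_convex (mcball x R)"
  unfolding geodesically_convex_def
proof (intro conjI ballI impI)
  show "p \<in> mcball x R" if "u \<in> mcball x R" "v \<in> mcball x R" "p \<in> M" "between u p v" for u v p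
  proof -
    have "d x p + d u v \<le> max (d x u + d p v) (d x v + d p u)" "d u v = d u p + d p v"
      "d x u \<le> R" "d x v \<le> R" "x \<in> M"
      using that four_point[of x p u v] by (auto simp: between_def)
    then show ?thesis
      using commute[of p u] nonneg[of p u] nonneg[of p v] that(3) by (auto simp: max_def simp del: nonneg split: if_splits)
  qed
qed auto

text \<open>
  The image of a geodesic is connected up to jumps of size \<open>c\<close>. Some arbitrarily short step of the
  geodesic is mapped from one side of \<open>q\<close> to the other, so \<open>q\<close> lies between the two values, and the nearer one is
  within half a jump.
\<close>

lemma coarse_connectedness:
  assumes qi: "quasi_isometry lam c B d M d f" and B: "geodesically_convex B" and lam: "1 \<le> lam"
    and u: "u \<in> B" and v: "v \<in> B" and q: "q \<in> M" "between (f u) q (f v)" and e: "0 < \<epsilon>"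
  shows "\<exists>s\<in>B. between u s v \<and> d (f s) q \<le> c / 2 + \<epsilon>"
proof -
  have BM: "B \<subseteq> M" using B by (simp add: geodesically_convex_def)
  have fM: "f x \<in> M" if "x \<in> B" for x using qi that by (auto simp: quasi_isometry_def)
  have "d (f u) (f u) \<le> lam * d u u + c" using qi u unfolding quasi_isometry_def by blast
  then have c0: "0 \<le> c" using mdist_zero[OF subsetD[OF BM u]] mdist_zero[OF fM[OF u]] by simp
  have "\<forall>a\<in>{0..d u v}. \<exists>p\<in>M. d u p = a \<and> d p v = d u v - a"
    using geodesic[OF subsetD[OF BM u] subsetD[OF BM v]] by simp
  then obtain \<gamma> where \<gamma>: "\<And>a. a \<in> {0..d u v} \<Longrightarrow> \<gamma> a \<in> M \<and> d u (\<gamma> a) = a \<and> d (\<gamma> a) v = d u v - a"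
    by metis
  have btw: "between u (\<gamma> a) v" "\<gamma> a \<in> B" if "a \<in> {0..d u v}" for a
  proof -
    show "between u (\<gamma> a) v" using \<gamma>[OF that] by (simp add: between_def)
    then show "\<gamma> a \<in> B" using B u v \<gamma>[OF that] unfolding geodesically_convex_def by blast
  qed
  have "0 \<in> {0..d u v}" "d u v \<in> {0..d u v}" by simp_all
  from \<gamma>[OF this(1)] \<gamma>[OF this(2)]
  have "\<gamma> 0 \<in> M" "\<gamma> (d u v) \<in> M" "d u (\<gamma> 0) = 0" "d (\<gamma> (d u v)) v = 0" by linarith+
  then have ends: "\<gamma> 0 = u" "\<gamma> (d u v) = v"
    using zero[OF subsetD[OF BM u]] zero[OF _ subsetD[OF BM v]] by blast+
  define P where "P a \<longleftrightarrow> between (f u) q (f (\<gamma> a))" for a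
  show ?thesis
  proof (cases "P 0")
    case True
    then have "d (f u) q = 0"
      using mdist_zero[OF fM[OF u]] commute[of q "f u"] by (simp add: P_def ends between_def)
    moreover have "between u u v" using mdist_zero[OF subsetD[OF BM u]] by (simp add: between_def)
    ultimately show ?thesis using u c0 e by (intro bexI[of _ u]) simp_all
  next
    case False
    have "P (d u v)" using q(2) by (simp add: P_def ends)
    moreover have "0 < 2 * \<epsilon> / lam" using e lam by simp
    ultimately obtain s t where st: "s \<in> {0..d u v}" "t \<in> {0..d u v}" "\<bar>s - t\<bar> \<le> 2 * \<epsilon> / lam"
      "\<not> P s" "P t"
      using discrete_crossing[of "d u v" P "2 * \<epsilon> / lam"] False by auto
    note s = btw[OF st(1)] and t = btw[OF st(2)]
    have "between (f (\<gamma> s)) q (f (\<gamma> t))"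
      using tripod[of "f u" q "f (\<gamma> t)" "f (\<gamma> s)"] st(4,5) fM u s t q(1) unfolding P_def by blast
    moreover have "d (f (\<gamma> s)) (f (\<gamma> t)) \<le> lam * d (\<gamma> s) (\<gamma> t) + c"
      using qi s t by (simp add: quasi_isometry_def)
    moreover have "d (\<gamma> s) (\<gamma> t) \<le> 2 * \<epsilon> / lam"
      using segment_dist[OF s(1) t(1)] \<gamma>[OF st(1)] \<gamma>[OF st(2)] st(3)
        subsetD[OF BM u] subsetD[OF BM v] by auto
    then have "lam * d (\<gamma> s) (\<gamma> t) \<le> 2 * \<epsilon>" using lam by (simp add: field_simps)
    ultimately have "d (f (\<gamma> s)) q + d q (f (\<gamma> t)) \<le> 2 * \<epsilon> + c"
      by (simp add: between_def)
    then have "d (f (\<gamma> s)) q \<le> c / 2 + \<epsilon> \<or> d (f (\<gamma> t)) q \<le> c / 2 + \<epsilon>"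
      using commute[of q "f (\<gamma> t)"] by linarith
    then show ?thesis using s t by blast
  qed
qed

text \<open>
  By \<open>coarse_connectedness\<close> the point of the geodesic between \<open>f a\<close> and \<open>f b\<close> nearest to \<open>f x\<close> is within \<open>c/2\<close>
  of some \<open>f s\<close> with \<open>s\<close> between \<open>a\<close> and \<open>b\<close>. The passage from \<open>x\<close>, \<open>s\<close> to their images costs another \<open>c\<close>.
\<close>

lemma gromov_product_quasi_isometry:
  assumes qi: "quasi_isometry lam c B d M d f" and B: "geodesically_convex B" and lam: "1 \<le> lam"
    and x: "x \<in> B" and a: "a \<in> B" and b: "b \<in> B"
  shows "gromov_product x a b / lam - 3 / 2 * c \<le> gromov_product (f x) (f a) (f b)"
proof (rule field_le_epsilon)
  fix e :: real assume e: "0 < e"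
  have BM: "B \<subseteq> M" using B by (simp add: geodesically_convex_def)
  have fM: "f x \<in> M" if "x \<in> B" for x using qi that by (auto simp: quasi_isometry_def)
  obtain q where q: "q \<in> M" "between (f a) q (f b)" "d (f x) q = gromov_product (f x) (f a) (f b)"
    using projection fM x a b by blast
  obtain s where s: "s \<in> B" "between a s b" "d (f s) q \<le> c / 2 + e"
    using coarse_connectedness[OF qi B lam a b q(1,2) e] by blast
  have "gromov_product x a b \<le> d x s" using gromov_product_le_segment s x a b BM by blast
  then have "gromov_product x a b / lam \<le> d x s / lam" using lam by (simp add: divide_right_mono)
  also have "\<dots> \<le> d (f x) (f s) + c"
  proof -
    have "1 / lam * d x s - c \<le> d (f x) (f s)" using qi x s(1) unfolding quasi_isometry_def by blast
    then show ?thesis by simp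
  qed
  also have "d (f x) (f s) \<le> d (f x) q + d (f s) q"
    using triangle[of "f x" q "f s"] fM x s(1) q(1) commute[of q "f s"] by simp
  finally show "gromov_product x a b / lam - 3 / 2 * c \<le> gromov_product (f x) (f a) (f b) + e"
    using s(3) q(3) by simp
qed

text \<open>
  If the image of the geodesic from \<open>u\<close> over \<open>p\<^sub>0\<close> to \<open>v\<close> passes \<open>z\<close> both before and after reaching \<open>f p\<^sub>0\<close>, it
  comes within \<open>c/2\<close> of \<open>z\<close> at parameters \<open>s\<close> and \<open>t\<close> on either side of \<open>p\<^sub>0\<close>. Then \<open>s\<close> and \<open>t\<close> are at most
  \<open>2 lam c\<close> apart, so one of them is within \<open>lam c\<close> of \<open>p\<^sub>0\<close>.
\<close>

lemma bounded_backtracking: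
  assumes qi: "quasi_isometry lam c B d M d f" and B: "geodesically_convex B" and lam: "1 \<le> lam"
    and p\<^sub>0: "p\<^sub>0 \<in> B" and u: "u \<in> B" and v: "v \<in> B" and uv: "between u p\<^sub>0 v"
    and z: "z \<in> M" "between (f u) z (f p\<^sub>0)" "between (f p\<^sub>0) z (f v)"
  shows "d (f p\<^sub>0) z \<le> lam\<^sup>2 * c + 3 / 2 * c"
proof (rule field_le_epsilon)
  fix e :: real assume e: "0 < e"
  have BM: "B \<subseteq> M" using B by (simp add: geodesically_convex_def)
  have fM: "f x \<in> M" if "x \<in> B" for x using qi that by (auto simp: quasi_isometry_def)
  \<comment> \<open>The error \<open>\<epsilon>\<close> of the two approximations is multiplied by \<open>lam\<^sup>2\<close> once and added once.\<close>
  define \<epsilon> where "\<epsilon> = e / (lam\<^sup>2 + 1)"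
  have l2: "0 < lam\<^sup>2 + 1" by (simp add: add_nonneg_pos)
  have eps: "0 < \<epsilon>" "(lam\<^sup>2 + 1) * \<epsilon> = e" using e l2 by (auto simp: \<epsilon>_def)
  obtain s where s: "s \<in> B" "between u s p\<^sub>0" "d (f s) z \<le> c / 2 + \<epsilon>"
    using coarse_connectedness[OF qi B lam u p\<^sub>0 z(1,2) eps(1)] by blast
  obtain t where t: "t \<in> B" "between p\<^sub>0 t v" "d (f t) z \<le> c / 2 + \<epsilon>"
    using coarse_connectedness[OF qi B lam p\<^sub>0 v z(1,3) eps(1)] by blast
  have "d s p\<^sub>0 + d p\<^sub>0 t \<le> d s t"
    using uv s(2) t(2) triangle[OF subsetD[OF BM u] subsetD[OF BM s(1)] subsetD[OF BM v]]
      triangle[OF subsetD[OF BM s(1)] subsetD[OF BM t(1)] subsetD[OF BM v]]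
    unfolding between_def by linarith
  moreover have "d s t / lam \<le> 2 * c + 2 * \<epsilon>"
  proof -
    have "1 / lam * d s t - c \<le> d (f s) (f t)"
      using qi s(1) t(1) by (simp add: quasi_isometry_def)
    moreover have "d (f s) (f t) \<le> d (f s) z + d (f t) z"
      using triangle[of "f s" z "f t"] fM s(1) t(1) z(1) commute[of z "f t"] by simp
    ultimately show ?thesis using s(3) t(3) by simp
  qed
  then have "d s t \<le> lam * (2 * c + 2 * \<epsilon>)" using lam by (simp add: field_simps)
  ultimately have "d p\<^sub>0 s \<le> lam * (c + \<epsilon>) \<or> d p\<^sub>0 t \<le> lam * (c + \<epsilon>)"
    using commute[of s p\<^sub>0] by (auto simp: algebra_simps)
  then obtain w where w: "w \<in> B" "d p\<^sub>0 w \<le> lam * (c + \<epsilon>)" "d (f w) z \<le> c / 2 + \<epsilon>"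
    using s t by blast
  have "d (f p\<^sub>0) (f w) \<le> lam * d p\<^sub>0 w + c" using qi p\<^sub>0 w(1) by (simp add: quasi_isometry_def)
  also have "lam * d p\<^sub>0 w \<le> lam * (lam * (c + \<epsilon>))" using w(2) lam by (intro mult_left_mono) auto
  finally have "d (f p\<^sub>0) (f w) \<le> lam\<^sup>2 * (c + \<epsilon>) + c" by (simp add: power2_eq_square mult.assoc)
  moreover have "d (f p\<^sub>0) z \<le> d (f p\<^sub>0) (f w) + d (f w) z"
    using triangle fM p\<^sub>0 w(1) z(1) by blast
  moreover have "lam\<^sup>2 * \<epsilon> + \<epsilon> = e" using eps(2) by (simp add: algebra_simps)
  ultimately show "d (f p\<^sub>0) z \<le> lam\<^sup>2 * c + 3 / 2 * c + e"
    using w(3) by (simp add: algebra_simps)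
qed

subsection \<open>Independent sets and spheres\<close>

text \<open>
  The hypothesis on Gromov products says that every point of \<open>X\<close> is at distance more than \<open>\<kappa>\<close> from the
  geodesics between the others, so \<open>X\<close> looks like the set of ends of the subtree that it spans. Seen from
  \<open>p\<^sub>0\<close>, the elements of \<open>X\<close> then are pairwise incomparable with a margin of \<open>\<kappa>\<close>, except possibly one, through
  which the subtree is entered. That one may be \<open>x0\<close>, the element that is allowed to lie outside the shadow of \<open>z\<close>.
\<close>

lemma at_most_one_root:
  assumes X: "X \<subseteq> M" "finite X" "3 \<le> card X" and p\<^sub>0: "p\<^sub>0 \<in> M" and z: "z \<in> M"
    and ind: "\<And>x a b. \<lbrakk>x \<in> X; a \<in> X; b \<in> X; a \<noteq> x; b \<noteq> x; a \<noteq> b\<rbrakk> \<Longrightarrow> \<kappa> < gromov_product x a b"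
    and out: "\<And>x. \<lbrakk>x \<in> X; x \<noteq> x0\<rbrakk> \<Longrightarrow> between p\<^sub>0 z x"
  shows "\<exists>r. \<forall>a\<in>X - {r}. between p\<^sub>0 z a \<and> (\<forall>b\<in>X - {r}. a \<noteq> b \<longrightarrow> \<kappa> < gromov_product a p\<^sub>0 b)"
proof -
  define bad where "bad p \<longleftrightarrow> \<not> between p\<^sub>0 z p \<or> (\<exists>b\<in>X. b \<noteq> p \<and> gromov_product p p\<^sub>0 b \<le> \<kappa>)" for p
  \<comment> \<open>If one other point parts from \<open>p\<close> within \<open>\<kappa>\<close> of \<open>p\<close> as seen from \<open>p\<^sub>0\<close>, all others do.\<close>
  have spread: "gromov_product p p\<^sub>0 a \<le> \<kappa>"
    if "p \<in> X" "b \<in> X" "b \<noteq> p" "gromov_product p p\<^sub>0 b \<le> \<kappa>" "a \<in> X" "a \<noteq> p" for p a b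
  proof (cases "a = b")
    case False
    then have "\<kappa> < gromov_product p a b" using ind that by blast
    moreover have "min (gromov_product p p\<^sub>0 a) (gromov_product p a b) \<le> gromov_product p p\<^sub>0 b"
      using gromov_product_ultra that X(1) p\<^sub>0 by blast
    ultimately show ?thesis using that(4) by linarith
  qed (use that in simp)
  have third: "\<exists>r\<in>X. r \<noteq> p \<and> r \<noteq> q" for p q
  proof (rule ccontr)
    assume "\<not> ?thesis"
    then have "X \<subseteq> {p, q}" by blast
    then have "card X \<le> card {p, q}" by (rule card_mono[rotated]) simp
    also have "\<dots> \<le> 2" by (simp add: card_insert_if)
    finally show False using X(3) by simp
  qed
  \<comment> \<open>From a point outside the shadow of \<open>z\<close> the shadow looks the same as from \<open>p\<^sub>0\<close>.\<close>
  have mixed: False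
    if pq: "p \<in> X" "q \<in> X" "p \<noteq> q" and p: "\<not> between p\<^sub>0 z p" and q: "bad q" for p q
  proof -
    have "p = x0" using out pq p by blast
    then have in_z: "between p\<^sub>0 z r" if "r \<in> X" "r \<noteq> p" for r using out that by blast
    then obtain b where b: "b \<in> X" "b \<noteq> q" "gromov_product q p\<^sub>0 b \<le> \<kappa>"
      using q pq by (auto simp: bad_def)
    obtain r where r: "r \<in> X" "r \<noteq> p" "r \<noteq> q" using third by blast
    have through: "d p a = d p z + (d p\<^sub>0 a - d p\<^sub>0 z)" if "a \<in> X" "a \<noteq> p" for a
    proof -
      have "between p z a" using tripod[OF in_z[OF that]] p that pq p\<^sub>0 z X(1) by blast
      then show ?thesis using in_z[OF that] by (simp add: between_def)
    qed
    have "gromov_product q p r = gromov_product q p\<^sub>0 r"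
      using through[OF pq(2)] through[OF r(1,2)] pq(3) commute[of q p] commute[of q p\<^sub>0]
      by (simp add: gromov_product_def)
    moreover have "gromov_product q p\<^sub>0 r \<le> \<kappa>" using spread[OF pq(2) b(1,2,3) r(1,3)] .
    moreover have "\<kappa> < gromov_product q p r" using ind pq r by blast
    ultimately show False by simp
  qed
  have uniq: "p = q" if pq: "p \<in> X" "q \<in> X" "bad p" "bad q" for p q
  proof (rule ccontr)
    assume ne: "p \<noteq> q"
    then have "between p\<^sub>0 z p" "between p\<^sub>0 z q" using mixed pq by blast+
    then obtain b b' where b: "b \<in> X" "b \<noteq> p" "gromov_product p p\<^sub>0 b \<le> \<kappa>" "b' \<in> X" "b' \<noteq> q" "gromov_product q p\<^sub>0 b' \<le> \<kappa>"
      using pq by (auto simp: bad_def)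
    obtain r where r: "r \<in> X" "r \<noteq> p" "r \<noteq> q" using third by blast
    \<comment> \<open>The products at \<open>p\<close> and \<open>q\<close> with third point \<open>p\<^sub>0\<close> add up to \<open>d p q\<close>, as do those with third point \<open>r\<close>.\<close>
    have "gromov_product p p\<^sub>0 q \<le> \<kappa>" using spread[OF pq(1) b(1-3) pq(2)] ne by simp
    moreover have "gromov_product q p\<^sub>0 p \<le> \<kappa>" using spread[OF pq(2) b(4-6) pq(1)] ne by simp
    moreover have "\<kappa> < gromov_product p q r" "\<kappa> < gromov_product q p r" using ind pq r ne by blast+
    ultimately show False
      using commute[of p q] commute[of p p\<^sub>0] commute[of q p\<^sub>0] by (simp add: gromov_product_def)
  qed
  obtain r where r: "\<And>p. p \<in> X \<Longrightarrow> p \<noteq> r \<Longrightarrow> \<not> bad p" using uniq by metis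
  show ?thesis
    by (rule exI[of _ r]) (use r in \<open>force simp: bad_def not_le\<close>)
qed

text \<open>
  Send each element of \<open>X\<close>, apart from the exceptional one of \<open>at_most_one_root\<close>, to a point of the
  sphere that precedes it or that it precedes, as seen from \<open>p\<^sub>0\<close>. Two elements with the same image either are
  comparable or have parted at most \<open>\<kappa>\<close> before each of them, and the margin excludes both.
\<close>

lemma independent_card_le_sphere:
  assumes X: "X \<subseteq> M" "finite X" "3 \<le> card X" and p\<^sub>0: "p\<^sub>0 \<in> M" and z: "z \<in> M"
    and ind: "\<And>x a b. \<lbrakk>x \<in> X; a \<in> X; b \<in> X; a \<noteq> x; b \<noteq> x; a \<noteq> b\<rbrakk> \<Longrightarrow> \<kappa> < gromov_product x a b"
    and out: "\<And>x. \<lbrakk>x \<in> X; x \<noteq> x0\<rbrakk> \<Longrightarrow> between p\<^sub>0 z x"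
    and R: "\<And>x. x \<in> X \<Longrightarrow> d p\<^sub>0 x \<le> R"
    and l: "d p\<^sub>0 z \<le> l" "R - l \<le> \<kappa>" and k: "0 \<le> \<kappa>"
    and ext: "\<And>a L. \<lbrakk>a \<in> M; d p\<^sub>0 a \<le> L\<rbrakk> \<Longrightarrow> \<exists>g\<in>M. between p\<^sub>0 a g \<and> d p\<^sub>0 g = L"
    and S: "finite {p \<in> M. between p\<^sub>0 z p \<and> d p\<^sub>0 p = l}"
  shows "card X \<le> card {p \<in> M. between p\<^sub>0 z p \<and> d p\<^sub>0 p = l} + 1"
proof -
  let ?S = "{p \<in> M. between p\<^sub>0 z p \<and> d p\<^sub>0 p = l}"
  obtain r where r: "\<forall>a\<in>X - {r}. between p\<^sub>0 z a \<and> (\<forall>b\<in>X - {r}. a \<noteq> b \<longrightarrow> \<kappa> < gromov_product a p\<^sub>0 b)"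
    using at_most_one_root[OF X p\<^sub>0 z ind out] by blast
  have "\<exists>g\<in>?S. between p\<^sub>0 g a \<or> between p\<^sub>0 a g" if a: "a \<in> X - {r}" for a
  proof -
    have aM: "a \<in> M" and za: "between p\<^sub>0 z a" using a X r by auto
    show ?thesis
    proof (cases "l \<le> d p\<^sub>0 a")
      case True
      moreover have "0 \<le> l" using l(1) nonneg[of p\<^sub>0 z] by linarith
      ultimately obtain g where g: "g \<in> M" "d p\<^sub>0 g = l" "d g a = d p\<^sub>0 a - l"
        using geodesic[OF p\<^sub>0 aM] by blast
      then have "between p\<^sub>0 g a" by (simp add: between_def)
      moreover have "between p\<^sub>0 z g"
        using segment_order[OF za \<open>between p\<^sub>0 g a\<close>] l(1) g p\<^sub>0 aM z by simp
      ultimately show ?thesis using g by blast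
    next
      case False
      then obtain g where g: "g \<in> M" "between p\<^sub>0 a g" "d p\<^sub>0 g = l" using ext[OF aM, of l] by auto
      then show ?thesis using between_extend[OF za g(2)] p\<^sub>0 z aM by blast
    qed
  qed
  then obtain G where G: "\<And>a. a \<in> X - {r} \<Longrightarrow> G a \<in> ?S \<and> (between p\<^sub>0 (G a) a \<or> between p\<^sub>0 a (G a))"
    by metis
  have "inj_on G (X - {r})"
  proof (rule inj_onI, rule ccontr)
    fix a b assume ab: "a \<in> X - {r}" "b \<in> X - {r}" "G a = G b" "a \<noteq> b"
    have M: "a \<in> M" "b \<in> M" "G a \<in> M" using ab X G by auto
    have gap: "\<kappa> < gromov_product a p\<^sub>0 b" "\<kappa> < gromov_product b p\<^sub>0 a" using r ab by auto
    have incomp: "\<not> between p\<^sub>0 a b" "\<not> between p\<^sub>0 b a"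
      using gap k commute[of a p\<^sub>0] commute[of b p\<^sub>0] commute[of a b] by (auto simp: between_def gromov_product_def)
    have "between p\<^sub>0 (G a) a \<and> between p\<^sub>0 (G a) b"
    proof (rule ccontr)
      assume "\<not> ?thesis"
      then consider "between p\<^sub>0 a (G a)" "between p\<^sub>0 b (G a)" | "between p\<^sub>0 a (G a)" "between p\<^sub>0 (G a) b"
        | "between p\<^sub>0 (G a) a" "between p\<^sub>0 b (G a)" using G ab(1,2,3) by metis
      then show False
      proof cases
        case 1
        then show False
          using segment_order[of p\<^sub>0 a "G a" b] segment_order[of p\<^sub>0 b "G a" a] M p\<^sub>0 incomp by linarith
      qed (use between_extend M p\<^sub>0 incomp in blast)+
    qed
    then have "d a b \<le> (d p\<^sub>0 a - l) + (d p\<^sub>0 b - l)"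
      using triangle[of a "G a" b] commute[of a "G a"] M G[OF ab(1)] unfolding between_def by auto
    then have "gromov_product a p\<^sub>0 b \<le> d p\<^sub>0 a - l" using commute[of a p\<^sub>0] by (simp add: gromov_product_def)
    also have "\<dots> \<le> \<kappa>" using R[of a] ab(1) l(2) by simp
    finally show False using gap(1) by simp
  qed
  moreover have "G ` (X - {r}) \<subseteq> ?S" using G by blast
  ultimately have "card (X - {r}) \<le> card ?S" using S by (rule card_inj_on_le)
  then show ?thesis using card_Diff1_le[of X r] X(2) by (cases "r \<in> X") (auto simp: card_Diff_singleton)
qed

end


section \<open>Regular metric trees\<close>

theorem tree_zero_hyperbolic:
  assumes "tree V E"
  shows "zero_hyperbolic (metric_tree E) (tree_dist E)"
proof -
  interpret Metric_space "metric_tree E" "tree_dist E" by (rule Metric_space_metric_tree[OF assms])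
  obtain r where "rooted_tree V E r" using tree_root[OF assms] by blast
  then show ?thesis
    by unfold_locales (auto intro: rooted_tree.tree_dist_four_point tree_dist_geodesic[OF assms])
qed

locale regular_metric_tree =
  fixes V :: "'v set" and E :: "'v set set" and deg :: nat
  assumes regular: "regular_tree deg V E" and deg3: "3 \<le> deg"
begin

lemma tree: "tree V E"
  using regular by (simp add: regular_tree_def)

sublocale zero_hyperbolic "metric_tree E" "tree_dist E"
  by (rule tree_zero_hyperbolic[OF tree])

abbreviation T where "T \<equiv> metric_tree E"
abbreviation dist where "dist \<equiv> tree_dist E"

lemma edge_neq: "{u, v} \<in> E \<Longrightarrow> u \<noteq> v"
  using tree simple_graph_edge_neq unfolding tree_def by metis

lemma edge_sym: "{u, v} \<in> E \<Longrightarrow> {v, u} \<in> E"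
  by (simp add: insert_commute)

lemma edge_in_V: "{u, v} \<in> E \<Longrightarrow> u \<in> V \<and> v \<in> V"
  using tree by (auto simp: tree_def simple_graph_def)

lemma vertex_point_in_T: "{u, v} \<in> E \<Longrightarrow> vertex_point u \<in> T \<and> vertex_point v \<in> T"
  using edge_point_in_metric_tree[of u v E 0] edge_point_in_metric_tree[of u v E 1]
    vertex_edge_point[of u v] edge_neq[of u v] by auto

lemma edge_dist:
  "{u, v} \<in> E \<Longrightarrow> s \<in> {0..1} \<Longrightarrow> t \<in> {0..1} \<Longrightarrow> dist (edge_point u v s) (edge_point u v t) = \<bar>s - t\<bar>"
  by (rule tree_dist_segment[OF tree])

lemma edge_dist_ends:
  assumes "{u, v} \<in> E" "t \<in> {0..1}"
  shows "dist (vertex_point u) (edge_point u v t) = t" "dist (vertex_point v) (edge_point u v t) = 1 - t"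
  using edge_dist[OF assms(1) _ assms(2), of 0] edge_dist[OF assms(1) _ assms(2), of 1]
    vertex_edge_point[of u v] edge_neq[OF assms(1)] assms(2) by auto

lemma edge_length: "{u, v} \<in> E \<Longrightarrow> dist (vertex_point u) (vertex_point v) = 1"
  using edge_dist_ends(1)[of u v 1] vertex_edge_point(2)[of u v] edge_neq by auto

lemma dichotomy:
  assumes "{u, v} \<in> E" "x \<in> T"
  obtains t where "t \<in> {0..1}" "x = edge_point u v t"
  | "dist (vertex_point u) x = 1 + dist (vertex_point v) x"
  | "dist (vertex_point v) x = 1 + dist (vertex_point u) x"
proof -
  obtain r where r: "rooted_tree V E r" using tree_root[OF tree] by blast
  show ?thesis using rooted_tree.edge_dichotomy[OF r assms] that by blast
qed

lemma dist_edge_point: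
  assumes "{u, v} \<in> E" "x \<in> T" "t \<in> {0..1}" "dist (vertex_point u) x = 1 + dist (vertex_point v) x"
  shows "dist (edge_point u v t) x = 1 - t + dist (vertex_point v) x"
proof -
  have e: "edge_point u v t \<in> T" using assms by auto
  note M = vertex_point_in_T[OF assms(1)] and D = edge_dist_ends[OF assms(1,3)]
  have "dist (vertex_point u) x \<le> t + dist (edge_point u v t) x"
    using triangle[of "vertex_point u" "edge_point u v t" x] M D e assms(2) by simp
  moreover have "dist (edge_point u v t) x \<le> 1 - t + dist (vertex_point v) x"
    using triangle[of "edge_point u v t" "vertex_point v" x] M D e assms(2) commute[of "vertex_point v"] by simp
  ultimately show ?thesis using assms(4) by simp
qed

lemma dist_edge_point':
  assumes "{u, v} \<in> E" "x \<in> T" "t \<in> {0..1}" "dist (vertex_point v) x = 1 + dist (vertex_point u) x"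
  shows "dist (edge_point u v t) x = t + dist (vertex_point u) x"
  using dist_edge_point[OF edge_sym[OF assms(1)] assms(2) _ assms(4), of "1 - t"] assms(3)
    edge_point_swap[of v u "1 - t"] edge_neq[OF assms(1)] by auto

lemma vertex_dist_ge_1:
  assumes "{u, u'} \<in> E" "{v, v'} \<in> E" "u \<noteq> v"
  shows "1 \<le> dist (vertex_point u) (vertex_point v)"
proof (rule tree_dist_greatest[OF tree])
  show "vertex_point u \<in> T" "vertex_point v \<in> T" using vertex_point_in_T assms by blast+
  fix l assume "chain E (vertex_point u) (vertex_point v) l"
  from chain_coord_le[OF _ this, of V u] show "1 \<le> l"
    using tree assms(3) by (simp add: tree_def vertex_point_def)
qed

lemma vertex_point_eq_edge_point: "vertex_point v = edge_point a b t \<Longrightarrow> v = a \<or> v = b"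
  by (auto simp: vertex_point_def edge_point_def fun_eq_iff split: if_splits)

text \<open>
  Distinct vertices are at distance at least 1, so a point closer than that to \<open>v\<close> is on an edge at \<open>v\<close>.
\<close>

lemma near_vertex:
  assumes ab: "{a, b} \<in> E" "s \<in> {0..1}" and v: "{v, v'} \<in> E"
    and near: "dist (edge_point a b s) (vertex_point v) < 1"
  shows "v = a \<or> v = b"
proof -
  have V: "vertex_point v \<in> T" using vertex_point_in_T[OF v] by simp
  show ?thesis
  proof (cases rule: dichotomy[OF ab(1) V])
    case (1 t) then show ?thesis using vertex_point_eq_edge_point by metis
  next
    case 2
    then show ?thesis
      using dist_edge_point[OF ab(1) V ab(2) 2] vertex_dist_ge_1[OF edge_sym[OF ab(1)] v] near ab(2) by force
  next
    case 3
    then show ?thesis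
      using dist_edge_point'[OF ab(1) V ab(2) 3] vertex_dist_ge_1[OF ab(1) v] near ab(2) by force
  qed
qed

text \<open>
  The geodesic from \<open>v\<close> to \<open>x\<close> starts along some edge \<open>{v, w}\<close>. By \<open>dichotomy\<close> it then either ends on this edge
  or runs through \<open>w\<close>.
\<close>

lemma exit_edge:
  assumes v: "{v, v'} \<in> E" and x: "x \<in> T"
  shows "\<exists>w. {v, w} \<in> E \<and> ((\<exists>t\<in>{0..1}. x = edge_point v w t) \<or> dist (vertex_point v) x = 1 + dist (vertex_point w) x)"
proof (cases "x = vertex_point v")
  case True
  then have "x = edge_point v v' 0" by (simp add: vertex_edge_point(1))
  moreover have "(0::real) \<in> {0..1}" by simp
  ultimately show ?thesis using v by blast
next
  case False
  have V: "vertex_point v \<in> T" using vertex_point_in_T[OF v] by simp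
  define a where "a = min (dist (vertex_point v) x) (1 / 2)"
  have a: "0 < a" "a \<le> dist (vertex_point v) x" "a < 1" using mdist_pos_less[OF _ V x] False by (auto simp: a_def)
  obtain p where p: "p \<in> T" "dist (vertex_point v) p = a" "dist p x = dist (vertex_point v) x - a"
    using geodesic[OF V x less_imp_le[OF a(1)] a(2)] by blast
  obtain b c s where bc: "p = edge_point b c s" "{b, c} \<in> E" "s \<in> {0..1}"
    using p(1) by (auto simp: metric_tree_def)
  have "v = b \<or> v = c" using near_vertex[OF bc(2,3) v] p(2) a(3) bc(1) commute[of p "vertex_point v"] by simp
  then obtain w r where w: "{v, w} \<in> E" "p = edge_point v w r" "r \<in> {0..1}"
  proof
    assume "v = c"
    then show ?thesis
      using that[of b "1 - s"] bc edge_point_swap[of b c s] edge_neq[OF bc(2)] by (auto simp: insert_commute)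
  qed (use bc that in auto)
  have "r = a" using edge_dist_ends(1)[OF w(1,3)] w(2) p(2) by simp
  have "dist (vertex_point w) x \<noteq> 1 + dist (vertex_point v) x"
    using dist_edge_point'[OF w(1) x w(3)] w(2) p(3) a(1) \<open>r = a\<close> by auto
  then show ?thesis using dichotomy[OF w(1) x] w(1) by metis
qed

subsection \<open>Counting points at a given distance\<close>

text \<open>
  Points at distance \<open>L\<close> from \<open>v\<close> whose geodesic from \<open>v\<close> does not use the edge \<open>{u, v}\<close>; for \<open>L = 0\<close> only \<open>v\<close>
  itself.
\<close>

definition sphere_beyond :: "'v \<Rightarrow> 'v \<Rightarrow> real \<Rightarrow> ('v \<Rightarrow> real) set" where
  "sphere_beyond u v L = {x \<in> T. dist (vertex_point v) x = L \<and> dist (vertex_point u) x = L + 1}"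

definition neighbours :: "'v \<Rightarrow> 'v set" where
  "neighbours v = {w. {v, w} \<in> E}"

lemma neighbours_card:
  assumes "v \<in> V"
  shows "finite (neighbours v)" "card (neighbours v) = deg"
proof -
  have "{e \<in> E. v \<in> e} = (\<lambda>w. {v, w}) ` neighbours v"
  proof (intro equalityI subsetI)
    fix e assume e: "e \<in> {e \<in> E. v \<in> e}"
    then have "card e = 2" using tree by (auto simp: tree_def simple_graph_def)
    then obtain a b where "e = {a, b}" by (auto simp: card_2_iff)
    then show "e \<in> (\<lambda>w. {v, w}) ` neighbours v" using e by (auto simp: neighbours_def insert_commute)
  qed (auto simp: neighbours_def)
  moreover have inj: "inj_on (\<lambda>w. {v, w}) (neighbours v)" by (auto simp: inj_on_def doubleton_eq_iff)
  ultimately have c: "card (neighbours v) = card {e \<in> E. v \<in> e}" by (simp add: card_image)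
  then show "card (neighbours v) = deg" using regular assms by (simp add: regular_tree_def degree_def)
  then show "finite (neighbours v)" using deg3 card.infinite by fastforce
qed

lemma other_neighbours:
  assumes "{u, v} \<in> E"
  shows "finite (neighbours v - {u})" "card (neighbours v - {u}) = deg - 1"
proof -
  have "v \<in> V" "u \<in> neighbours v" using edge_in_V assms by (auto simp: neighbours_def insert_commute)
  then show "finite (neighbours v - {u})" "card (neighbours v - {u}) = deg - 1" using neighbours_card[of v] by auto
qed

lemma path_between:
  assumes "{u, v} \<in> E" "{v, w} \<in> E" "w \<noteq> u"
  shows "between (vertex_point u) (vertex_point v) (vertex_point w)"
proof -
  have w: "vertex_point w \<in> T" "vertex_point u \<in> T" using vertex_point_in_T assms by blast+
  show ?thesis
  proof (cases rule: dichotomy[OF assms(1) w(1)])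
    case (1 t)
    then show ?thesis using vertex_point_eq_edge_point[of w u v t] edge_neq[OF assms(2)] assms(3) by auto
  next
    case 2 then show ?thesis using edge_length[OF assms(1)] by (simp add: between_def)
  next
    case 3
    then have "vertex_point u = vertex_point w" using edge_length[OF assms(2)] zero[OF w(2,1)] by simp
    then show ?thesis using assms(3) by simp
  qed
qed

lemma sphere_beyond_extend:
  assumes "{u, v} \<in> E" "{v, w} \<in> E" "w \<noteq> u" "x \<in> T" "dist (vertex_point w) x < 1 + dist (vertex_point v) x"
  shows "x \<in> sphere_beyond u v (dist (vertex_point v) x)"
proof -
  have T: "vertex_point u \<in> T" "vertex_point v \<in> T" "vertex_point w \<in> T" using vertex_point_in_T assms(1,2) by blast+
  have "\<not> between x (vertex_point v) (vertex_point w)"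
    using assms(5) edge_length[OF assms(2)] commute[of x "vertex_point v"] commute[of x "vertex_point w"] by (simp add: between_def)
  then have "between (vertex_point u) (vertex_point v) x"
    using tripod[OF path_between[OF assms(1-3)]] T assms(4) by blast
  then show ?thesis using edge_length[OF assms(1)] assms(4) by (simp add: between_def sphere_beyond_def)
qed

lemma sphere_beyond_cases:
  assumes uv: "{u, v} \<in> E" and L: "0 < L" and x: "x \<in> sphere_beyond u v L"
  shows "\<exists>w\<in>neighbours v - {u}. x \<in> (if L < 1 then {edge_point v w L} else sphere_beyond v w (L - 1))"
proof -
  have xT: "x \<in> T" and d: "dist (vertex_point v) x = L" "dist (vertex_point u) x = L + 1"
    using x by (auto simp: sphere_beyond_def)
  obtain w where w: "{v, w} \<in> E"
    "(\<exists>t\<in>{0..1}. x = edge_point v w t) \<or> dist (vertex_point v) x = 1 + dist (vertex_point w) x"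
    using exit_edge[OF edge_sym[OF uv] xT] by blast
  from w(2) show ?thesis
  proof
    assume "\<exists>t\<in>{0..1}. x = edge_point v w t"
    then obtain t where t: "t \<in> {0..1}" "x = edge_point v w t" by blast
    have tL: "t = L" using edge_dist_ends(1)[OF w(1) t(1)] t(2) d(1) by simp
    have dw: "dist (vertex_point w) x = 1 - L" using edge_dist_ends(2)[OF w(1) t(1)] t(2) tL by simp
    then have "w \<noteq> u" using d(2) L by auto
    then show ?thesis using w(1) t tL d(1) dw xT
      by (intro bexI[of _ w]) (auto simp: neighbours_def sphere_beyond_def)
  next
    assume dw: "dist (vertex_point v) x = 1 + dist (vertex_point w) x"
    then have "w \<noteq> u" using d by auto
    moreover have "1 \<le> L" using dw d(1) nonneg[of "vertex_point w" x] by linarith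
    moreover from this have "\<not> L < 1" by simp
    ultimately show ?thesis using w(1) dw d(1) xT
      by (intro bexI[of _ w]) (auto simp: neighbours_def sphere_beyond_def)
  qed
qed

text \<open>
  The number of points is multiplied by \<open>deg - 1\<close> at each vertex that is passed. These vertices are at the
  integral distances from \<open>v\<close> smaller than \<open>L\<close>, starting with \<open>v\<close> itself at distance 0.
\<close>

lemma sphere_beyond_card_le:
  assumes "{u, v} \<in> E" "0 \<le> L" "L \<le> real n"
  shows "finite (sphere_beyond u v L) \<and> card (sphere_beyond u v L) \<le> (deg - 1) ^ n"
  using assms
proof (induction n arbitrary: u v L)
  case 0
  have "sphere_beyond u v 0 \<subseteq> {vertex_point v}"
    using zero[of "vertex_point v"] vertex_point_in_T[OF 0(1)] by (auto simp: sphere_beyond_def)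
  then show ?case using 0 card_mono[of "{vertex_point v}"] by (auto intro: finite_subset)
next
  case (Suc n)
  show ?case
  proof (cases "L = 0")
    case True
    have "sphere_beyond u v 0 \<subseteq> {vertex_point v}"
      using zero[of "vertex_point v"] vertex_point_in_T[OF Suc(2)] by (auto simp: sphere_beyond_def)
    then have "finite (sphere_beyond u v 0)" "card (sphere_beyond u v 0) \<le> 1"
      using card_mono[of "{vertex_point v}"] by (auto intro: finite_subset)
    moreover have "1 \<le> (deg - 1) ^ Suc n" using deg3 by simp
    ultimately show ?thesis using True by (metis le_trans)
  next
    case False
    define F where "F w = (if L < 1 then {edge_point v w L} else sphere_beyond v w (L - 1))" for w
    have F: "finite (F w) \<and> card (F w) \<le> (deg - 1) ^ n" if "w \<in> neighbours v - {u}" for w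
      using that Suc.IH[of v w "L - 1"] Suc.prems deg3 by (auto simp: F_def neighbours_def)
    have sub: "sphere_beyond u v L \<subseteq> (\<Union>w\<in>neighbours v - {u}. F w)"
      using sphere_beyond_cases[OF Suc.prems(1), of L] False Suc.prems(2) by (auto simp: F_def)
    have fin: "finite (\<Union>w\<in>neighbours v - {u}. F w)" using F other_neighbours[OF Suc.prems(1)] by blast
    have "card (sphere_beyond u v L) \<le> card (\<Union>w\<in>neighbours v - {u}. F w)" by (rule card_mono[OF fin sub])
    also have "\<dots> \<le> (\<Sum>w\<in>neighbours v - {u}. card (F w))" by (rule card_UN_le) (rule other_neighbours[OF Suc.prems(1)])
    also have "\<dots> \<le> (\<Sum>w\<in>neighbours v - {u}. (deg - 1) ^ n)" using F by (intro sum_mono) blast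
    also have "\<dots> = (deg - 1) ^ Suc n" using other_neighbours[OF Suc.prems(1)] by simp
    finally show ?thesis using finite_subset[OF sub fin] by simp
  qed
qed

lemma branch_separation:
  assumes "{v, w} \<in> E" "{v, w'} \<in> E" "w \<noteq> w'" "x \<in> T" "x' \<in> T"
    and "dist (vertex_point w) x < 1 + dist (vertex_point v) x" "dist (vertex_point w') x' < 1 + dist (vertex_point v) x'"
  shows "between x (vertex_point v) x'"
proof -
  have T: "vertex_point v \<in> T" "vertex_point w \<in> T" "vertex_point w' \<in> T" using vertex_point_in_T assms(1,2) by blast+
  have vw': "dist (vertex_point w') (vertex_point v) = 1" using edge_length[OF edge_sym[OF assms(2)]] .
  have "x \<in> sphere_beyond w' v (dist (vertex_point v) x)"
    using sphere_beyond_extend[OF edge_sym[OF assms(2)] assms(1,3,4,6)] .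
  then have "between (vertex_point w') (vertex_point v) x" using vw' by (simp add: sphere_beyond_def between_def)
  moreover have "\<not> between (vertex_point w') (vertex_point v) x'" using vw' assms(7) by (simp add: between_def)
  ultimately have "between x' (vertex_point v) x" using tripod T assms(4,5) by blast
  then show ?thesis by (rule between_sym)
qed

lemma branch_nonempty:
  assumes "{v, w} \<in> E" "0 < L"
  shows "\<exists>x\<in>T. dist (vertex_point v) x = L \<and> dist (vertex_point w) x < 1 + L"
proof -
  have "\<exists>x\<in>T. dist (vertex_point v) x = L \<and> dist (vertex_point w) x < 1 + L" if "L \<le> real (Suc n)" for n
    using that assms
  proof (induction n arbitrary: v w L)
    case 0
    then show ?case using edge_dist_ends[of v w L] by (intro bexI[of _ "edge_point v w L"]) auto
  next
    case (Suc n)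
    show ?case
    proof (cases "L \<le> 1")
      case True
      then show ?thesis
        using edge_dist_ends[of v w L] Suc.prems by (intro bexI[of _ "edge_point v w L"]) auto
    next
      case False
      have "card (neighbours w - {v}) \<noteq> 0" using other_neighbours[OF Suc.prems(2)] deg3 by simp
      then obtain y where y: "y \<in> neighbours w - {v}" by (metis card.empty ex_in_conv)
      then have wy: "{w, y} \<in> E" "y \<noteq> v" by (auto simp: neighbours_def)
      obtain x where x: "x \<in> T" "dist (vertex_point w) x = L - 1" "dist (vertex_point y) x < 1 + (L - 1)"
        using Suc.IH[OF _ wy(1), of "L - 1"] False Suc.prems by auto
      then have "x \<in> sphere_beyond v w (L - 1)"
        using sphere_beyond_extend[OF Suc.prems(2) wy x(1)] by simp
      then show ?thesis using x(1) by (auto simp: sphere_beyond_def)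
    qed
  qed
  moreover obtain n where "L \<le> real n" using real_arch_simple by blast
  then have "L \<le> real (Suc n)" by simp
  ultimately show ?thesis by blast
qed

text \<open>
  Beyond \<open>v\<close> there are at least \<open>n\<close> vertices on the way, and all \<open>deg - 1\<close> directions are taken at each of the
  first \<open>n\<close> of them. Two of the points part at one of these vertices, hence within distance \<open>n\<close> of \<open>v\<close>, and
  go on for at least \<open>L - n\<close>.
\<close>

lemma branch_separated_set:
  assumes "{v, w} \<in> E" "real n < L"
  shows "\<exists>X\<subseteq>{x \<in> T. dist (vertex_point v) x = L \<and> dist (vertex_point w) x < 1 + L}.
    card X = (deg - 1) ^ n \<and> (\<forall>x\<in>X. \<forall>y\<in>X. x \<noteq> y \<longrightarrow> 2 * (L - real n) \<le> dist x y)"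
  using assms
proof (induction n arbitrary: v w L)
  case 0
  then obtain x where "x \<in> T" "dist (vertex_point v) x = L" "dist (vertex_point w) x < 1 + L"
    using branch_nonempty[of v w L] by auto
  then show ?case by (intro exI[of _ "{x}"]) auto
next
  case (Suc n)
  note vw = Suc.prems(1)
  let ?B = "\<lambda>y. {x \<in> T. dist (vertex_point w) x = L - 1 \<and> dist (vertex_point y) x < 1 + (L - 1)}"
  define Q where "Q y X \<longleftrightarrow> X \<subseteq> ?B y \<and> card X = (deg - 1) ^ n \<and>
      (\<forall>x\<in>X. \<forall>z\<in>X. x \<noteq> z \<longrightarrow> 2 * (L - 1 - real n) \<le> dist x z)" for y X
  have "\<exists>X. Q y X" if "y \<in> neighbours w - {v}" for y
    unfolding Q_def by (rule Suc.IH) (use that Suc.prems(2) in \<open>simp_all add: neighbours_def\<close>)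
  then obtain X where QX: "\<And>y. y \<in> neighbours w - {v} \<Longrightarrow> Q y (X y)" by metis
  have XB: "x \<in> ?B y" if "y \<in> neighbours w - {v}" "x \<in> X y" for x y
    using QX[OF that(1)] that(2) unfolding Q_def by (meson subsetD)
  have Xcard: "card (X y) = (deg - 1) ^ n" if "y \<in> neighbours w - {v}" for y
    using QX[OF that] by (simp add: Q_def)
  have wT: "vertex_point w \<in> T" using vertex_point_in_T[OF vw] by simp
  have across: "dist x z = 2 * (L - 1)"
    if "y \<in> neighbours w - {v}" "y' \<in> neighbours w - {v}" "y \<noteq> y'" "x \<in> X y" "z \<in> X y'" for x z y y'
  proof -
    have "x \<in> ?B y" "z \<in> ?B y'" by (intro XB that)+
    moreover from this have "between x (vertex_point w) z"
      using branch_separation[of w y y' x z] that by (auto simp: neighbours_def)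
    ultimately show ?thesis using commute[of x "vertex_point w"] by (auto simp: between_def)
  qed
  have L1: "0 < L - 1" using Suc.prems(2) by simp
  have disj: "X y \<inter> X y' = {}" if "y \<in> neighbours w - {v}" "y' \<in> neighbours w - {v}" "y \<noteq> y'" for y y'
  proof (rule equals0I)
    fix x assume x: "x \<in> X y \<inter> X y'"
    then have "dist x x = 2 * (L - 1)" using across[OF that] by blast
    moreover have "x \<in> T" using XB[OF that(1)] x by simp
    ultimately show False using L1 mdist_zero by simp
  qed
  have pos: "0 < (deg - 1) ^ n" using deg3 by simp
  have fin: "finite (X y)" if "y \<in> neighbours w - {v}" for y
    using Xcard[OF that] pos card.infinite by fastforce
  have "card (\<Union>y\<in>neighbours w - {v}. X y) = (\<Sum>y\<in>neighbours w - {v}. card (X y))"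
    using other_neighbours[OF vw] fin disj by (intro card_UN_disjoint) auto
  also have "\<dots> = (\<Sum>y\<in>neighbours w - {v}. (deg - 1) ^ n)" using Xcard by (intro sum.cong) auto
  also have "\<dots> = (deg - 1) ^ Suc n" using other_neighbours[OF vw] by simp
  finally have card: "card (\<Union>y\<in>neighbours w - {v}. X y) = (deg - 1) ^ Suc n" .
  have sub: "x \<in> T \<and> dist (vertex_point v) x = L \<and> dist (vertex_point w) x < 1 + L"
    if "y \<in> neighbours w - {v}" "x \<in> X y" for x y
  proof -
    have x: "x \<in> ?B y" by (rule XB[OF that])
    then have "x \<in> sphere_beyond v w (L - 1)"
      using sphere_beyond_extend[of v w y x] vw that(1) by (auto simp: neighbours_def)
    then show ?thesis using x by (auto simp: sphere_beyond_def)
  qed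
  have sep: "2 * (L - real (Suc n)) \<le> dist x z"
    if "y \<in> neighbours w - {v}" "x \<in> X y" "y' \<in> neighbours w - {v}" "z \<in> X y'" "x \<noteq> z" for x z y y'
  proof (cases "y = y'")
    case True then show ?thesis using QX[OF that(1)] that by (simp add: Q_def algebra_simps)
  next
    case False then show ?thesis using across[OF that(1,3) False that(2,4)] by simp
  qed
  show ?case
    by (rule exI[of _ "\<Union>y\<in>neighbours w - {v}. X y"]) (use card sub sep in auto)
qed

subsection \<open>The displacement of the centre\<close>


text \<open>
  Points on the sphere of radius \<open>L\<close> about \<open>a\<close>, as many as \<open>n\<close> branchings produce, that part from one
  another at distance at least \<open>L - n\<close> before the sphere.
\<close>

definition separated_leaves :: "('v \<Rightarrow> real) \<Rightarrow> real \<Rightarrow> nat \<Rightarrow> ('v \<Rightarrow> real) set \<Rightarrow> bool" where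
  "separated_leaves a L n X \<longleftrightarrow> (\<forall>x\<in>X. x \<in> T \<and> dist a x = L) \<and> card X = (deg - 1) ^ n \<and>
    (\<forall>x\<in>X. \<forall>y\<in>X. x \<noteq> y \<longrightarrow> 2 * (L - real n) \<le> dist x y)"

text \<open>
  The two directions along an edge containing \<open>a\<close> are treated alike. For a vertex \<open>a\<close> one of them is the
  whole of the other branches at \<open>a\<close>.
\<close>

lemma opposite_branches:
  assumes "a \<in> T" "1 \<le> L" "real n < L"
  shows "\<exists>X Y. separated_leaves a L n X \<and> separated_leaves a L n Y \<and> (\<forall>x\<in>X. \<forall>y\<in>Y. between x a y)"
proof -
  obtain u v s where a: "a = edge_point u v s" and uv: "{u, v} \<in> E" and s: "s \<in> {0..1}"
    using assms(1) by (auto simp: metric_tree_def)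
  note vu = edge_sym[OF uv]
  have beyond: "dist (vertex_point u) x = 1 + dist (vertex_point v) x"
    if "{u, v} \<in> E" "x \<in> T" "1 \<le> dist (vertex_point u) x" "dist (vertex_point v) x < 1 + dist (vertex_point u) x" for u v x
  proof (cases rule: dichotomy[OF that(1,2)])
    case (1 t)
    then show ?thesis using edge_dist_ends[OF that(1), of t] that(3) by auto
  qed (use that(4) in auto)
  have a': "a = edge_point v u (1 - s)" using a edge_point_swap edge_neq[OF uv] by metis
  obtain X where X: "X \<subseteq> {x \<in> T. dist (vertex_point u) x = L + s \<and> dist (vertex_point v) x < 1 + (L + s)}"
    "card X = (deg - 1) ^ n" "\<forall>x\<in>X. \<forall>y\<in>X. x \<noteq> y \<longrightarrow> 2 * (L + s - real n) \<le> dist x y"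
    using branch_separated_set[OF uv, of n "L + s"] assms s by auto
  obtain Y where Y: "Y \<subseteq> {x \<in> T. dist (vertex_point v) x = L + (1 - s) \<and> dist (vertex_point u) x < 1 + (L + (1 - s))}"
    "card Y = (deg - 1) ^ n" "\<forall>x\<in>Y. \<forall>y\<in>Y. x \<noteq> y \<longrightarrow> 2 * (L + (1 - s) - real n) \<le> dist x y"
    using branch_separated_set[OF vu, of n "L + (1 - s)"] assms s by auto
  have x: "x \<in> T \<and> dist (vertex_point v) x = L - (1 - s) \<and> dist (vertex_point u) x = L + s \<and> dist a x = L"
    if "x \<in> X" for x
  proof -
    have *: "x \<in> T" "dist (vertex_point u) x = L + s" "dist (vertex_point v) x < 1 + (L + s)" using X(1) that by auto
    then have **: "dist (vertex_point u) x = 1 + dist (vertex_point v) x" using beyond[OF uv] assms(2) s by auto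
    show ?thesis using * ** dist_edge_point[OF uv *(1) s **] a by simp
  qed
  have y: "y \<in> T \<and> dist (vertex_point u) y = L - s \<and> dist a y = L"
    if "y \<in> Y" for y
  proof -
    have *: "y \<in> T" "dist (vertex_point v) y = L + (1 - s)" "dist (vertex_point u) y < 1 + (L + (1 - s))" using Y(1) that by auto
    then have **: "dist (vertex_point v) y = 1 + dist (vertex_point u) y" using beyond[OF vu] assms(2) s by auto
    show ?thesis using * ** dist_edge_point'[OF uv *(1) s **] a by simp
  qed
  have btw: "between x a y" if xy: "x \<in> X" "y \<in> Y" for x y
  proof -
    note x = x[OF xy(1)] and y = y[OF xy(2)]
    have T: "vertex_point u \<in> T" "vertex_point v \<in> T" using vertex_point_in_T[OF uv] by auto
    have len: "dist (vertex_point v) (vertex_point u) = 1" by (rule edge_length[OF vu])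
    have "y \<in> {x \<in> T. dist (vertex_point v) x = L + (1 - s) \<and> dist (vertex_point u) x < 1 + (L + (1 - s))}"
      using Y(1) xy(2) by blast
    then have "between (vertex_point v) (vertex_point u) y" using y len by (simp add: between_def)
    moreover have "\<not> between (vertex_point v) (vertex_point u) x" using x len by (simp add: between_def)
    ultimately have "between x (vertex_point u) y" using tripod T x y by blast
    then have "dist x y = 2 * L" using x y commute[of x "vertex_point u"] by (simp add: between_def)
    then show ?thesis using x y commute[of x a] by (simp add: between_def)
  qed
  have "2 * (L - real n) \<le> dist x x'" if "x \<in> X" "x' \<in> X" "x \<noteq> x'" for x x'
  proof -
    have "2 * (L + s - real n) \<le> dist x x'" using X(3) that by blast
    then show ?thesis using s by simp
  qed
  then have "separated_leaves a L n X" using x X(2) by (simp add: separated_leaves_def)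
  moreover have "2 * (L - real n) \<le> dist x x'" if "x \<in> Y" "x' \<in> Y" "x \<noteq> x'" for x x'
  proof -
    have "2 * (L + (1 - s) - real n) \<le> dist x x'" using Y(3) that by blast
    then show ?thesis using s by simp
  qed
  then have "separated_leaves a L n Y" using y Y(2) by (simp add: separated_leaves_def)
  ultimately show ?thesis using btw by blast
qed

text \<open>
  Of two opposite continuations at \<open>a\<close>, one does not lead back to \<open>p\<^sub>0\<close>.
\<close>

lemma geodesic_extension:
  assumes "p\<^sub>0 \<in> T" "a \<in> T" "dist p\<^sub>0 a \<le> L"
  shows "\<exists>g\<in>T. between p\<^sub>0 a g \<and> dist p\<^sub>0 g = L"
proof -
  define t where "t = L - dist p\<^sub>0 a"
  have t: "0 \<le> t" using assms(3) by (simp add: t_def)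
  obtain X Y where X: "separated_leaves a (t + 1) 0 X" and Y: "separated_leaves a (t + 1) 0 Y"
    and XY: "\<forall>x\<in>X. \<forall>y\<in>Y. between x a y"
    using opposite_branches[OF assms(2), of "t + 1" 0] t by auto
  have "X \<noteq> {}" "Y \<noteq> {}" using X Y by (auto simp: separated_leaves_def)
  then obtain x y where xy: "x \<in> X" "y \<in> Y" by blast
  have x: "x \<in> T" "dist a x = t + 1" and y: "y \<in> T" "dist a y = t + 1"
    using X Y xy by (auto simp: separated_leaves_def)
  have "between x a y" using XY xy by blast
  then have "between x a p\<^sub>0 \<or> between p\<^sub>0 a y" using tripod x y assms by blast
  then obtain e where e: "e \<in> T" "dist a e = t + 1" "between p\<^sub>0 a e"
    using x y between_sym by blast
  obtain g where g: "g \<in> T" "dist a g = t" "dist g e = 1"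
    using geodesic[OF assms(2) e(1), of t] e(2) t by auto
  have "dist p\<^sub>0 g = L"
    using triangle[of p\<^sub>0 g e] triangle[of p\<^sub>0 a g] assms e g unfolding between_def t_def by simp
  then show ?thesis using g by (intro bexI[of _ g]) (auto simp: between_def t_def)
qed

text \<open>
  The last edge of the geodesic from \<open>p\<^sub>0\<close> to \<open>z\<close>, oriented away from \<open>p\<^sub>0\<close>; the final alternative says
  whether \<open>p\<^sub>0\<close> is on this edge too.
\<close>

lemma oriented_edge:
  assumes z: "z \<in> T" and p0: "p\<^sub>0 \<in> T" and ne: "z \<noteq> p\<^sub>0"
  obtains u v t where "{u, v} \<in> E" "z = edge_point u v t" "0 < t" "t \<le> 1"
    "(\<exists>s. 0 \<le> s \<and> s < t \<and> p\<^sub>0 = edge_point u v s) \<or> dist (vertex_point v) p\<^sub>0 = 1 + dist (vertex_point u) p\<^sub>0"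
proof -
  note found = that
  obtain a b t where ab: "z = edge_point a b t" "{a, b} \<in> E" "t \<in> {0..1}"
    using z by (auto simp: metric_tree_def)
  have vertex: thesis if v: "z = vertex_point v" "{v, v'} \<in> E" for v v'
  proof -
    obtain w where w: "{v, w} \<in> E"
      "(\<exists>t\<in>{0..1}. p\<^sub>0 = edge_point v w t) \<or> dist (vertex_point v) p\<^sub>0 = 1 + dist (vertex_point w) p\<^sub>0"
      using exit_edge[OF v(2) p0] by blast
    note wv = edge_sym[OF w(1)]
    have z1: "z = edge_point w v 1" using v vertex_edge_point(2)[of w v] edge_neq[OF wv] by simp
    from w(2) show thesis
    proof
      assume "\<exists>t\<in>{0..1}. p\<^sub>0 = edge_point v w t"
      then obtain t where t: "t \<in> {0..1}" "p\<^sub>0 = edge_point v w t" by blast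
      then have "t \<noteq> 0" using ne v(1) vertex_edge_point(1)[of v w] by auto
      then have "\<exists>s. 0 \<le> s \<and> s < 1 \<and> p\<^sub>0 = edge_point w v s"
        using t edge_point_swap[OF edge_neq[OF w(1)]] by (intro exI[of _ "1 - t"]) simp
      then show thesis using found[OF wv z1] by simp
    qed (use found[OF wv z1] in simp)
  qed
  show thesis
  proof (cases "t = 0 \<or> t = 1")
    case True
    then show thesis
      using vertex[of a b] vertex[of b a] ab edge_sym vertex_edge_point[of a b] edge_neq[OF ab(2)] by auto
  next
    case False
    note ba = edge_sym[OF ab(2)]
    have z': "z = edge_point b a (1 - t)" using ab(1) edge_point_swap edge_neq[OF ab(2)] by metis
    show thesis
    proof (cases rule: dichotomy[OF ab(2) p0])
      case (1 s)
      then have "s \<noteq> t" using ne ab(1) by auto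
      then have "s < t \<and> 0 \<le> s \<and> p\<^sub>0 = edge_point a b s \<or>
          1 - s < 1 - t \<and> 0 \<le> 1 - s \<and> p\<^sub>0 = edge_point b a (1 - s)"
        using 1 edge_point_swap[OF edge_neq[OF ab(2)]] by auto
      then show thesis
      proof
        assume "s < t \<and> 0 \<le> s \<and> p\<^sub>0 = edge_point a b s"
        then show thesis using found[OF ab(2,1)] ab(3) by auto
      next
        assume *: "1 - s < 1 - t \<and> 0 \<le> 1 - s \<and> p\<^sub>0 = edge_point b a (1 - s)"
        then have "\<exists>s'. 0 \<le> s' \<and> s' < 1 - t \<and> p\<^sub>0 = edge_point b a s'" by blast
        then show thesis using found[OF ba z'] ab(3) False by simp
      qed
    next
      case 2 then show thesis using found[OF ba z'] ab(3) False by auto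
    next
      case 3 then show thesis using found[OF ab(2,1)] ab(3) False by auto
    qed
  qed
qed

text \<open>
  With the edge through \<open>z\<close> oriented away from \<open>p\<^sub>0\<close>, the shadow of \<open>z\<close> is the rest of this edge together with
  everything beyond its far end \<open>v\<close>. A length \<open>g \<le> n\<close> beyond \<open>z\<close> leads past at most \<open>n\<close> vertices.
\<close>

lemma card_shadow_sphere_le:
  assumes z: "z \<in> T" and p0: "p\<^sub>0 \<in> T" and ne: "z \<noteq> p\<^sub>0" and g: "0 \<le> g" "g \<le> real n"
  shows "finite {p \<in> T. between p\<^sub>0 z p \<and> dist z p = g} \<and>
    card {p \<in> T. between p\<^sub>0 z p \<and> dist z p = g} \<le> (deg - 1) ^ n"
proof -
  let ?S = "{p \<in> T. between p\<^sub>0 z p \<and> dist z p = g}"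
  obtain u v t where uv: "{u, v} \<in> E" and zt: "z = edge_point u v t" and t: "0 < t" "t \<le> 1"
    and side: "(\<exists>s. 0 \<le> s \<and> s < t \<and> p\<^sub>0 = edge_point u v s) \<or> dist (vertex_point v) p\<^sub>0 = 1 + dist (vertex_point u) p\<^sub>0"
    using oriented_edge[OF z p0 ne] by blast
  have t01: "t \<in> {0..1}" using t by simp
  have T: "vertex_point u \<in> T" "vertex_point v \<in> T" using vertex_point_in_T[OF uv] by auto
  have S: "t + g \<le> 1 \<and> p = edge_point u v (t + g) \<or> dist (vertex_point v) p = g - (1 - t) \<and> dist (vertex_point u) p = g + t"
    if p: "p \<in> ?S" for p
  proof -
    have pT: "p \<in> T" and btw: "dist p\<^sub>0 p = dist p\<^sub>0 z + g" "dist z p = g"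
      using p by (auto simp: between_def)
    show ?thesis
    proof (cases rule: dichotomy[OF uv pT])
      case (1 r)
      have zr: "\<bar>t - r\<bar> = g" using edge_dist[OF uv t01 1(1)] zt 1(2) btw by simp
      have "t \<le> r"
        using side
      proof
        assume "\<exists>s. 0 \<le> s \<and> s < t \<and> p\<^sub>0 = edge_point u v s"
        then obtain s where s: "0 \<le> s" "s < t" "p\<^sub>0 = edge_point u v s" by blast
        then have "\<bar>s - r\<bar> = \<bar>s - t\<bar> + g"
          using edge_dist[OF uv _ 1(1), of s] edge_dist[OF uv _ t01, of s] t zt 1(2) btw(1) by simp
        then show ?thesis using zr s(2) by linarith
      next
        assume far: "dist (vertex_point v) p\<^sub>0 = 1 + dist (vertex_point u) p\<^sub>0"
        then show ?thesis
          using dist_edge_point'[OF uv p0 1(1) far] dist_edge_point'[OF uv p0 t01 far] zt 1(2) btw(1)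
            commute[of p\<^sub>0 p] commute[of p\<^sub>0 z] g(1) by simp
      qed
      then show ?thesis using zr 1 by auto
    next
      case 2
      then show ?thesis using dist_edge_point[OF uv pT t01 2] zt btw(2) by simp
    next
      case 3
      have d: "g = t + dist (vertex_point u) p" using dist_edge_point'[OF uv pT t01 3] zt btw(2) by simp
      have False
        using side
      proof
        assume "\<exists>s. 0 \<le> s \<and> s < t \<and> p\<^sub>0 = edge_point u v s"
        then obtain s where s: "0 \<le> s" "s < t" "p\<^sub>0 = edge_point u v s" by blast
        then have "dist p\<^sub>0 p = s + dist (vertex_point u) p" "dist p\<^sub>0 z = t - s"
          using dist_edge_point'[OF uv pT _ 3, of s] edge_dist[OF uv _ t01, of s] t zt by auto
        then show False using btw(1) d s(2) by simp
      next
        assume far: "dist (vertex_point v) p\<^sub>0 = 1 + dist (vertex_point u) p\<^sub>0"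
        have "dist p\<^sub>0 z = t + dist (vertex_point u) p\<^sub>0"
          using dist_edge_point'[OF uv p0 t01 far] zt commute[of p\<^sub>0 z] by simp
        moreover have "dist p\<^sub>0 p \<le> dist (vertex_point u) p\<^sub>0 + dist (vertex_point u) p"
          using triangle[of p\<^sub>0 "vertex_point u" p] p0 T pT commute[of p\<^sub>0 "vertex_point u"] by simp
        ultimately show False using btw(1) d t(1) by simp
      qed
      then show ?thesis ..
    qed
  qed
  show ?thesis
  proof (cases "g < 1 - t")
    case True
    have "?S \<subseteq> {edge_point u v (t + g)}"
    proof
      fix p assume p: "p \<in> ?S"
      then have "dist (vertex_point v) p \<noteq> g - (1 - t)" using nonneg[of "vertex_point v" p] True by linarith
      then show "p \<in> {edge_point u v (t + g)}" using S[OF p] by simp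
    qed
    then have "finite ?S" "card ?S \<le> 1"
      using card_mono[of "{edge_point u v (t + g)}" ?S] by (auto intro: finite_subset)
    moreover have "1 \<le> (deg - 1) ^ n" using deg3 by simp
    ultimately show ?thesis by linarith
  next
    case False
    have sub: "?S \<subseteq> sphere_beyond u v (g - (1 - t))"
    proof
      fix p assume p: "p \<in> ?S"
      have "dist (vertex_point v) p = g - (1 - t) \<and> dist (vertex_point u) p = g + t"
        using S[OF p]
      proof
        assume e: "t + g \<le> 1 \<and> p = edge_point u v (t + g)"
        then have "t + g = 1" using False by simp
        then show ?thesis using e edge_dist_ends[OF uv, of 1] by simp
      qed
      then show "p \<in> sphere_beyond u v (g - (1 - t))" using p by (simp add: sphere_beyond_def)
    qed
    have fin: "finite (sphere_beyond u v (g - (1 - t)))"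
      and "card (sphere_beyond u v (g - (1 - t))) \<le> (deg - 1) ^ n"
      using sphere_beyond_card_le[OF uv, of "g - (1 - t)" n] False g t by auto
    then show ?thesis using card_mono[OF fin sub] finite_subset[OF sub fin] by linarith
  qed
qed

text \<open>
  The comparison of the branch with the shadow. The leaf \<open>y\<close> of another branch joins \<open>X\<close> because
  \<open>independent_card_le_sphere\<close> loses one point: without it, the \<open>(deg - 1)\<^sup>n\<close> leaves would only be compared
  with \<open>(deg - 1)\<^bsup>n - 1\<^esup> + 1\<close>, which is no contradiction if \<open>deg = 3\<close> and \<open>n = 1\<close>. Its image is the one
  element that may be outside the shadow.
\<close>

lemma no_leaves_in_deep_shadow:
  assumes qi: "quasi_isometry lam c B dist T dist f" and lam: "1 \<le> lam" and c: "0 \<le> c"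
    and B: "geodesically_convex B" and fB: "\<And>x. x \<in> B \<Longrightarrow> dist p\<^sub>0 (f x) \<le> R"
    and p0: "p\<^sub>0 \<in> T" and z: "z \<in> T" and zR: "dist p\<^sub>0 z \<le> R"
    and n: "1 \<le> n" "3 / 2 * lam * c < R - real n" "R - real n \<le> 3 / 2 * lam * c + 1"
    and deep: "lam + 3 / 2 * lam * c < dist p\<^sub>0 z"
    and XB: "X \<subseteq> B" and leaves: "separated_leaves p\<^sub>0 R n X"
    and y: "y \<in> B" "dist p\<^sub>0 y = R" "\<And>x. x \<in> X \<Longrightarrow> between x p\<^sub>0 y"
    and shadow: "\<And>x. x \<in> X \<Longrightarrow> between p\<^sub>0 z (f x)"
  shows False
proof -
  have BM: "B \<subseteq> T" using B by (simp add: geodesically_convex_def)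
  have fT: "f x \<in> T" if "x \<in> B" for x using qi that by (auto simp: quasi_isometry_def)
  have Xcard: "card X = (deg - 1) ^ n" and Xdist: "\<And>x. x \<in> X \<Longrightarrow> dist p\<^sub>0 x = R"
    and Xsep: "\<And>x x'. x \<in> X \<Longrightarrow> x' \<in> X \<Longrightarrow> x \<noteq> x' \<Longrightarrow> 2 * (R - real n) \<le> dist x x'"
    using leaves by (auto simp: separated_leaves_def)
  define K where "K = R - real n"
  \<comment> \<open>The radius of the sphere on which the ends are counted: at most \<open>n - 1\<close> beyond \<open>z\<close>, so that it meets the
    shadow of \<open>z\<close> in at most \<open>(deg - 1)\<^bsup>n - 1\<^esup>\<close> points.\<close>
  define l where "l = min R (dist p\<^sub>0 z + real n - 1)"
  have K: "3 / 2 * lam * c < K" "K \<le> 3 / 2 * lam * c + 1" using n by (auto simp: K_def)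
  have lc: "0 \<le> 3 / 2 * lam * c" using lam c by simp
  have K0: "0 < K" using K(1) lc by linarith
  let ?A = "insert y X"
  have AB: "?A \<subseteq> B" using XB y(1) by simp
  have pos: "0 < (deg - 1) ^ n" using deg3 by simp
  then have finX: "finite X" by (intro card_ge_0_finite) (simp add: Xcard)
  have yX: "y \<notin> X"
  proof
    assume yX: "y \<in> X"
    then have "dist y y = 2 * R" using y(3)[OF yX] y(2) commute[of y p\<^sub>0] by (simp add: between_def)
    moreover have "dist y y = 0" using y(1) BM by (intro mdist_zero) auto
    ultimately show False using K0 by (simp add: K_def)
  qed
  have RA: "dist p\<^sub>0 x = R" if "x \<in> ?A" for x using that Xdist y(2) by auto
  have sepA: "2 * K \<le> dist x x'" if "x \<in> ?A" "x' \<in> ?A" "x \<noteq> x'" for x x'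
  proof -
    have "2 * K \<le> dist x y" "2 * K \<le> dist y x" if "x \<in> X" for x
      using y(3)[OF that] Xdist[OF that] y(2) commute[of x p\<^sub>0] commute[of y x]
      by (simp_all add: between_def K_def)
    then show ?thesis using that Xsep by (auto simp: K_def)
  qed
  \<comment> \<open>All points of \<open>?A\<close> are on one sphere about \<open>p\<^sub>0\<close>, where the distance is an ultrametric.\<close>
  have gpA: "K \<le> gromov_product x a b" if "x \<in> ?A" "a \<in> ?A" "b \<in> ?A" "a \<noteq> x" "b \<noteq> x" "a \<noteq> b" for x a b
  proof -
    have "dist a b + dist x p\<^sub>0 \<le> max (dist a x + dist b p\<^sub>0) (dist a p\<^sub>0 + dist b x)"
      by (rule four_point) (use that AB BM p0 in auto)
    then have "dist a b \<le> max (dist x a) (dist x b)"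
      using RA[OF that(1)] RA[OF that(2)] RA[OF that(3)] commute[of a x] commute[of b x]
        commute[of a p\<^sub>0] commute[of b p\<^sub>0] commute[of x p\<^sub>0] by linarith
    then show ?thesis
      using sepA[OF that(1,2)] sepA[OF that(1,3)] that(4,5) by (auto simp: gromov_product_def)
  qed
  have inj: "inj_on f ?A"
  proof (rule inj_onI, rule ccontr)
    fix x a assume xa: "x \<in> ?A" "a \<in> ?A" "f x = f a" "x \<noteq> a"
    have "1 / lam * dist x a - c \<le> dist (f x) (f a)"
      using qi xa AB unfolding quasi_isometry_def by blast
    also have "\<dots> = 0" using xa fT AB by auto
    finally have "dist x a \<le> lam * c" using lam by (simp add: field_simps)
    moreover have "0 \<le> lam * c" using lam c by simp
    ultimately show False using sepA[OF xa(1,2,4)] K(1) by linarith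
  qed
  have kappa: "R - l < K / lam - 3 / 2 * c"
  proof -
    have "3 / 2 * c < K / lam" using K(1) lam by (simp add: field_simps)
    moreover have "K + 1 - dist p\<^sub>0 z < K / lam - 3 / 2 * c"
    proof -
      have "K * (1 - 1 / lam) \<le> (3 / 2 * lam * c + 1) * (1 - 1 / lam)"
        using K(2) lam by (intro mult_right_mono) auto
      also have "\<dots> = 3 / 2 * lam * c - 3 / 2 * c + 1 - 1 / lam" using lam by (simp add: field_simps)
      finally have "K - K / lam \<le> 3 / 2 * lam * c - 3 / 2 * c + 1 - 1 / lam"
        by (simp add: algebra_simps)
      moreover have "2 - lam \<le> 1 / lam"
        using lam zero_le_square[of "lam - 1"] by (simp add: field_simps)
      ultimately show ?thesis using deep by linarith
    qed
    moreover have "R - l = 0 \<or> R - l = K + 1 - dist p\<^sub>0 z" by (auto simp: l_def K_def min_def)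
    ultimately show ?thesis by linarith
  qed
  have S_eq: "{p \<in> T. between p\<^sub>0 z p \<and> dist p\<^sub>0 p = l} = {p \<in> T. between p\<^sub>0 z p \<and> dist z p = l - dist p\<^sub>0 z}"
    by (auto simp: between_def)
  have "0 < dist p\<^sub>0 z" using deep lam lc by linarith
  then have z_ne: "z \<noteq> p\<^sub>0" using mdist_zero[OF p0] by auto
  have lz: "dist p\<^sub>0 z \<le> l" "l - dist p\<^sub>0 z \<le> real (n - 1)"
    using zR n(1) by (auto simp: l_def of_nat_diff)
  have S: "finite {p \<in> T. between p\<^sub>0 z p \<and> dist p\<^sub>0 p = l}"
    "card {p \<in> T. between p\<^sub>0 z p \<and> dist p\<^sub>0 p = l} \<le> (deg - 1) ^ (n - 1)"
    using card_shadow_sphere_le[OF z p0 z_ne, of "l - dist p\<^sub>0 z" "n - 1"] lz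
    unfolding S_eq by auto
  have cardA: "card (f ` ?A) = (deg - 1) ^ n + 1"
    using card_image[OF inj] Xcard finX yX by simp
  have "(deg - 1) ^ n = (deg - 1) * (deg - 1) ^ (n - 1)" using n(1) by (cases n) simp_all
  moreover have "2 * (deg - 1) ^ (n - 1) \<le> (deg - 1) * (deg - 1) ^ (n - 1)" using deg3 by (intro mult_right_mono) auto
  moreover have "1 \<le> (deg - 1) ^ (n - 1)" using deg3 by simp
  ultimately have grow: "(deg - 1) ^ (n - 1) < (deg - 1) ^ n" "2 \<le> (deg - 1) ^ n" by linarith+
  have "card (f ` ?A) \<le> card {p \<in> T. between p\<^sub>0 z p \<and> dist p\<^sub>0 p = l} + 1"
  proof (rule independent_card_le_sphere)
    show "f ` ?A \<subseteq> T" using fT AB by blast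
    show "finite (f ` ?A)" using finX by simp
    show "3 \<le> card (f ` ?A)" using cardA grow(2) by simp
    show "R - l < gromov_product x a b"
      if xab: "x \<in> f ` ?A" "a \<in> f ` ?A" "b \<in> f ` ?A" "a \<noteq> x" "b \<noteq> x" "a \<noteq> b" for x a b
    proof -
      obtain x' a' b' where p: "x' \<in> ?A" "a' \<in> ?A" "b' \<in> ?A" "x = f x'" "a = f a'" "b = f b'"
        using xab(1-3) by blast
      then have "K \<le> gromov_product x' a' b'" using xab(4-6) by (intro gpA) auto
      then have "K / lam \<le> gromov_product x' a' b' / lam" using lam by (simp add: divide_right_mono)
      moreover have "gromov_product x' a' b' / lam - 3 / 2 * c \<le> gromov_product x a b"
        using gromov_product_quasi_isometry[OF qi B lam] p AB by blast
      ultimately show ?thesis using kappa by linarith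
    qed
    show "between p\<^sub>0 z x" if "x \<in> f ` ?A" "x \<noteq> f y" for x using that shadow by auto
    show "dist p\<^sub>0 x \<le> R" if "x \<in> f ` ?A" for x using that fB AB by auto
    show "dist p\<^sub>0 z \<le> l" by (rule lz(1))
    show "0 \<le> R - l" by (simp add: l_def)
    show "\<exists>g\<in>T. between p\<^sub>0 a g \<and> dist p\<^sub>0 g = L" if "a \<in> T" "dist p\<^sub>0 a \<le> L" for a L
      using geodesic_extension[OF p0 that] .
  qed (use p0 z S in auto)
  then show False using cardA S(2) grow(1) by linarith
qed

text \<open>
  If \<open>f p\<^sub>0\<close> is far from \<open>p\<^sub>0\<close>, there is room for a point \<open>z\<close> between them that is deep enough for
  \<open>no_leaves_in_deep_shadow\<close> and far enough from \<open>f p\<^sub>0\<close> for \<open>bounded_backtracking\<close>.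
\<close>

theorem centre_displacement:
  assumes p0: "p\<^sub>0 \<in> T" and R: "0 \<le> R" and B: "B = mcball p\<^sub>0 R" and lam: "1 \<le> lam" and c: "0 \<le> c"
    and sqi: "self_quasi_isometry lam c B dist f"
  shows "dist p\<^sub>0 (f p\<^sub>0) \<le> 312 * lam\<^sup>2 * c + c + lam * (c + 1)"
proof (rule ccontr)
  assume big: "\<not> ?thesis"
  define r where "r = dist p\<^sub>0 (f p\<^sub>0)"
  have BT: "B \<subseteq> T" by (auto simp: B)
  have fB: "f x \<in> B" if "x \<in> B" for x
    using sqi that by (auto simp: self_quasi_isometry_def quasi_isometry_def)
  have qi: "quasi_isometry lam c B dist T dist f"
    using sqi BT unfolding self_quasi_isometry_def quasi_isometry_def by blast
  have conv: "geodesically_convex B" using mcball_convex by (simp add: B)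
  have p0B: "p\<^sub>0 \<in> B" using p0 R by (simp add: B)
  have fp0: "f p\<^sub>0 \<in> T" "r \<le> R" using fB[OF p0B] by (auto simp: B r_def)
  have lamc: "0 \<le> lam * c" using lam c by simp
  have l2c: "lam * c \<le> lam\<^sup>2 * c" "c \<le> lam * c"
    using lam c mult_right_mono[of 1 lam "lam * c"] mult_right_mono[of 1 lam c] lamc
    by (auto simp: power2_eq_square mult.assoc)
  have r: "312 * (lam\<^sup>2 * c) + c + lam * c + lam < r"
    using big by (simp add: r_def algebra_simps)
  \<comment> \<open>Both requirements on \<open>z\<close> are strict even for \<open>c = 0\<close>, where only \<open>lam < r\<close> is known; the midpoint
    of \<open>lam\<close> and \<open>r\<close> leaves room on both sides.\<close>
  define \<rho> where "\<rho> = (r + lam) / 2"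
  have rho: "0 \<le> \<rho>" "\<rho> \<le> r" using r lam c lamc l2c by (auto simp: \<rho>_def)
  obtain z where z: "z \<in> T" "dist p\<^sub>0 z = \<rho>" "dist z (f p\<^sub>0) = r - \<rho>"
    using geodesic[OF p0 fp0(1) rho(1)] rho(2) by (auto simp: r_def)
  have zf: "between p\<^sub>0 z (f p\<^sub>0)" using z by (simp add: between_def r_def)
  \<comment> \<open>\<open>n\<close> is the largest integer with \<open>3/2 lam c < R - n\<close>; the subtraction of 1 makes the inequality strict.\<close>
  define m where "m = \<lceil>R - 3 / 2 * lam * c\<rceil>"
  define n where "n = nat (m - 1)"
  have R1: "1 < R - 3 / 2 * lam * c" using r fp0(2) lam c lamc l2c by simp
  then have "1 < m" unfolding m_def less_ceiling_iff by simp
  then have n1: "1 \<le> n" and n_eq: "real n = of_int m - 1"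
    by (auto simp: n_def)
  have n: "3 / 2 * lam * c < R - real n" "R - real n \<le> 3 / 2 * lam * c + 1"
    using n_eq[unfolded m_def] ceiling_correct[of "R - 3 / 2 * lam * c"] by linarith+
  have nR: "real n < R" "1 \<le> R" using n(1) lamc n1 by auto
  obtain X Y where X: "separated_leaves p\<^sub>0 R n X" and Y: "separated_leaves p\<^sub>0 R n Y"
    and XY: "\<forall>x\<in>X. \<forall>y\<in>Y. between x p\<^sub>0 y"
    using opposite_branches[OF p0 nR(2,1)] by blast
  have XB: "X \<subseteq> B" "Y \<subseteq> B" and XR: "\<And>x. x \<in> X \<union> Y \<Longrightarrow> dist p\<^sub>0 x = R"
    using X Y p0 by (auto simp: B separated_leaves_def)
  have "0 < (deg - 1) ^ n" using deg3 by simp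
  then have ne: "X \<noteq> {}" "Y \<noteq> {}" using X Y by (auto simp: separated_leaves_def)
  have fR: "dist p\<^sub>0 (f x) \<le> R" if "x \<in> B" for x using fB[OF that] by (simp add: B)
  have deep: "lam + 3 / 2 * lam * c < dist p\<^sub>0 z" using r z(2) lamc l2c c by (simp add: \<rho>_def)
  have one_side: "between p\<^sub>0 z (f x) \<or> between p\<^sub>0 z (f y)" if "x \<in> X" "y \<in> Y" for x y
  proof (rule ccontr)
    assume n: "\<not> ?thesis"
    have xy: "x \<in> B" "y \<in> B" using that XB by auto
    then have fT: "f x \<in> T" "f y \<in> T" using fB BT by auto
    have "between (f x) z (f p\<^sub>0)" "between (f p\<^sub>0) z (f y)"
      using tripod[OF zf p0 fp0(1) _ z(1)] fT n between_sym by blast+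
    then have "dist (f p\<^sub>0) z \<le> lam\<^sup>2 * c + 3 / 2 * c"
      using bounded_backtracking[OF qi conv lam p0B xy XY[rule_format, OF that] z(1)] by simp
    then show False
      using z(3) commute[of z "f p\<^sub>0"] r lamc l2c c unfolding \<rho>_def by argo
  qed
  have zR: "dist p\<^sub>0 z \<le> R" using z(2) rho(2) fp0(2) by simp
  note deep_shadow = no_leaves_in_deep_shadow[OF qi lam c conv fR p0 z(1) zR n1 n deep]
  show False
  proof (cases "\<forall>x\<in>X. between p\<^sub>0 z (f x)")
    case True
    obtain y where y: "y \<in> Y" using ne by blast
    show False
      by (rule deep_shadow[OF _ XB(1) X, of y]) (use XY XB XR y True in auto)
  next
    case False
    then obtain x where x: "x \<in> X" "\<not> between p\<^sub>0 z (f x)" by blast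
    have "between y p\<^sub>0 x" "between p\<^sub>0 z (f y)" if "y \<in> Y" for y
      using XY x one_side[OF x(1) that] that between_sym by blast+
    then show False
      by (intro deep_shadow[OF _ XB(2) Y, of x]) (use XB XR x in auto)
  qed
qed

end


theorem proposition1:
  fixes V :: "'v set" and E :: "'v set set" and d :: nat
    and lam c R :: real and p\<^sub>0 :: "'v \<Rightarrow> real" and B :: "('v \<Rightarrow> real) set"
    and f :: "('v \<Rightarrow> real) \<Rightarrow> ('v \<Rightarrow> real)"
  assumes "3 \<le> d"
    and "regular_tree d V E"
    and "p\<^sub>0 \<in> metric_tree E"
    and "0 \<le> R"
    and "B = Metric_space.mcball (metric_tree E) (tree_dist E) p\<^sub>0 R"
    and "1 \<le> lam" and "0 \<le> c"
    and "self_quasi_isometry lam c B (tree_dist E) f"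
  shows "tree_dist E (f p\<^sub>0) p\<^sub>0 \<le> min R (morse_const_tree lam c + c + lam * (c + 1))"
proof -
  interpret regular_metric_tree V E d by unfold_locales (use assms in auto)
  have "p\<^sub>0 \<in> B" using assms(3,4,5) by simp
  then have "f p\<^sub>0 \<in> B" using assms(8) by (auto simp: self_quasi_isometry_def quasi_isometry_def)
  then have "tree_dist E p\<^sub>0 (f p\<^sub>0) \<le> R" using assms(5) by simp
  moreover have "tree_dist E p\<^sub>0 (f p\<^sub>0) \<le> 312 * lam\<^sup>2 * c + c + lam * (c + 1)"
    by (rule centre_displacement[OF assms(3-8)])
  ultimately show ?thesis
    by (simp add: morse_const_tree_def morse_A1_def commute[of "f p\<^sub>0"])
qed

end
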